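(* Let $G$ be a finite group. Any multiplicatively cohomological $G$-Tambara functor is also additively cohomological.
   Context: A $G$-Tambara functor $T$ assigns to each finite $G$-set $X$ a commutative ring $T(X)$ and to each $G$-map $f\colon X\to Y$ a ring homomorphism $f^*\colon T(Y)\to T(X)$ (restriction), a homomorphism of additive groups $f_+\colon T(X)\to T(Y)$ (transfer) and a homomorphism of multiplicative monoids $f_\times\colon T(X)\to T(Y)$ (norm) such that: $f^*$ is contravariantly functorial and $f_+,f_\times$ are covariantly functorial; $T(X\amalg Y)\cong T(X)\times T(Y)$ via the restrictions, and $T(\emptyset)=0$; for each pullback square with $f\colon X\to Y$, $g\colon Y'\to Y$, $X'=X\times_Y Y'$ and projections $f'\colon X'\to Y'$, $g'\colon X'\to X$ one has $g^*f_+=f'_+g'^*$ and $g^*f_\times=f'_\times g'^*$; and for $q\colon A\to X$, $f\colon X\to Y$, setting $\Pi=\{(y,s): y\in Y,\ s\colon f^{-1}(y)\to A,\ q\circ s=\mathrm{id}\}$, with $p\colon\Pi\to Y$ and $r\colon X\times_Y\Pi\to\Pi$ the projections and $e\colon X\times_Y\Pi\to A$, $(x,(y,s))\mapsto s(x)$, one has $f_\times q_+=p_+r_\times e^*$. For $H\le K\le G$, the maps $\mathrm{res}^K_H\colon T(G/K)\to T(G/H)$, $\mathrm{tr}^K_H\colon T(G/H)\to T(G/K)$ and $\mathrm{nm}^K_H\colon T(G/H)\to T(G/K)$ are the restriction, transfer and norm along the projection $G/H\to G/K$. $T$ is additively cohomological if for all $H\le K\le G$ the composite $\mathrm{tr}^K_H\circ\mathrm{res}^K_H$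 on $T(G/K)$ is multiplication by the integer $|K/H|$. $T$ is multiplicatively cohomological if for all $H\le K\le G$ the composite $\mathrm{nm}^K_H\circ\mathrm{res}^K_H$ on $T(G/K)$ is the $|K/H|$-th power map. *)

theory Defs
  imports
    "HOL-Algebra.Group_Action"
    "HOL-Algebra.Left_Coset"
    "HOL-Algebra.Chinese_Remainder"
    "HOL-Library.FSet"
begin

text \<open>
  A functor on finite \<open>G\<close>-sets has to be indexed by \<open>G\<close>-sets with points in one fixed type.
  The type below contains the orbits \<open>G/H\<close> and is closed under the constructions that occur in the
  axioms of a Tambara functor (disjoint unions, pullbacks, sections over a fibre).
  It is infinite, hence every finite \<open>G\<close>-set is isomorphic to one with points in it.
\<close>

datatype 'g point =
    Coset_pt "'g set"
  | In1 "'g point"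
  | In2 "'g point"
  | Tup (fst_pt: "'g point") (snd_pt: "'g point")
  | Section_pt (graph_of: "('g point \<times> 'g point) fset")

record ('g, 'x) gset =
  pts :: "'x set"
  act :: "'g \<Rightarrow> 'x \<Rightarrow> 'x"

type_synonym 'g pset = "('g, 'g point) gset"

definition fin_gset :: "('g, 'm) monoid_scheme \<Rightarrow> ('g, 'x) gset \<Rightarrow> bool" where
  "fin_gset G X \<longleftrightarrow> finite (pts X) \<and> group_action G (pts X) (act X)"

text \<open>
  \<open>G\<close>-maps are taken extensional, so that a \<open>G\<close>-map is determined by its values on \<open>X\<close>;
  they compose by \<^const>\<open>compose\<close>.
\<close>

definition gmaps :: "('g, 'm) monoid_scheme \<Rightarrow> ('g, 'x) gset \<Rightarrow> ('g, 'y) gset \<Rightarrow> ('x \<Rightarrow> 'y) set" where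
  "gmaps G X Y = {f \<in> pts X \<rightarrow>\<^sub>E pts Y.
     \<forall>g\<in>carrier G. \<forall>x\<in>pts X. f (act X g x) = act Y g (f x)}"


subsection \<open>Orbits\<close>

definition orbit_gset :: "('g, 'm) monoid_scheme \<Rightarrow> 'g set \<Rightarrow> 'g pset" where
  "orbit_gset G H =
    \<lparr>pts = Coset_pt ` (lcosets\<^bsub>G\<^esub> H),
     act = (\<lambda>g. \<lambda>p\<in>Coset_pt ` (lcosets\<^bsub>G\<^esub> H). case p of Coset_pt C \<Rightarrow> Coset_pt (g <#\<^bsub>G\<^esub> C))\<rparr>"

text \<open>For \<open>H \<subseteq> K\<close> one has \<open>(aH)K = aK\<close>, so this is the map \<open>aH \<mapsto> aK\<close>.\<close>

definition orbit_proj :: "('g, 'm) monoid_scheme \<Rightarrow> 'g set \<Rightarrow> 'g set \<Rightarrow> 'g point \<Rightarrow> 'g point" where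
  "orbit_proj G H K =
    (\<lambda>p\<in>pts (orbit_gset G H). case p of Coset_pt C \<Rightarrow> Coset_pt (C <#>\<^bsub>G\<^esub> K))"


subsection \<open>Disjoint unions\<close>

definition coprod_gset :: "'g pset \<Rightarrow> 'g pset \<Rightarrow> 'g pset" where
  "coprod_gset X Y =
    \<lparr>pts = In1 ` pts X \<union> In2 ` pts Y,
     act = (\<lambda>g. \<lambda>p\<in>In1 ` pts X \<union> In2 ` pts Y.
       case p of In1 x \<Rightarrow> In1 (act X g x) | In2 y \<Rightarrow> In2 (act Y g y))\<rparr>"

definition inj1 :: "'g pset \<Rightarrow> 'g point \<Rightarrow> 'g point" where
  "inj1 X = (\<lambda>x\<in>pts X. In1 x)"

definition inj2 :: "'g pset \<Rightarrow> 'g point \<Rightarrow> 'g point" where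
  "inj2 Y = (\<lambda>y\<in>pts Y. In2 y)"


subsection \<open>Pullbacks\<close>

definition pullback_gset ::
  "'g pset \<Rightarrow> ('g point \<Rightarrow> 'g point) \<Rightarrow> 'g pset \<Rightarrow> ('g point \<Rightarrow> 'g point) \<Rightarrow> 'g pset" where
  "pullback_gset X f Y' g =
    (let P = {Tup x y |x y. x \<in> pts X \<and> y \<in> pts Y' \<and> f x = g y}
     in \<lparr>pts = P, act = (\<lambda>a. \<lambda>p\<in>P. Tup (act X a (fst_pt p)) (act Y' a (snd_pt p)))\<rparr>)"

definition pullback_fst ::
  "'g pset \<Rightarrow> ('g point \<Rightarrow> 'g point) \<Rightarrow> 'g pset \<Rightarrow> ('g point \<Rightarrow> 'g point) \<Rightarrow> 'g point \<Rightarrow> 'g point" where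
  "pullback_fst X f Y' g = restrict fst_pt (pts (pullback_gset X f Y' g))"

definition pullback_snd ::
  "'g pset \<Rightarrow> ('g point \<Rightarrow> 'g point) \<Rightarrow> 'g pset \<Rightarrow> ('g point \<Rightarrow> 'g point) \<Rightarrow> 'g point \<Rightarrow> 'g point" where
  "pullback_snd X f Y' g = restrict snd_pt (pts (pullback_gset X f Y' g))"


subsection \<open>Sections over fibres\<close>

text \<open>A function \<open>s\<close> on the finite set \<open>D\<close> is encoded as a point by its graph.\<close>

definition encode_section :: "'g point set \<Rightarrow> ('g point \<Rightarrow> 'g point) \<Rightarrow> 'g point" where
  "encode_section D s = Section_pt (Abs_fset ((\<lambda>x. (x, s x)) ` D))"

definition apply_section :: "'g point \<Rightarrow> 'g point \<Rightarrow> 'g point" where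
  "apply_section \<sigma> x = (THE a. (x, a) |\<in>| graph_of \<sigma>)"

definition fibre :: "('g, 'x) gset \<Rightarrow> ('x \<Rightarrow> 'y) \<Rightarrow> 'y \<Rightarrow> 'x set" where
  "fibre X f y = {x \<in> pts X. f x = y}"

text \<open>
  For \<open>q : A \<rightarrow> X\<close> and \<open>f : X \<rightarrow> Y\<close>, the \<open>G\<close>-set of pairs \<open>(y, s)\<close> with \<open>s\<close> a section of \<open>q\<close> over the
  fibre of \<open>f\<close> at \<open>y\<close>. The group acts on sections by conjugation:
  \<open>g(y, s) = (gy, x \<mapsto> g s(g\<inverse>x))\<close>.
\<close>

definition dep_prod_gset ::
  "('g, 'm) monoid_scheme \<Rightarrow> 'g pset \<Rightarrow> ('g point \<Rightarrow> 'g point) \<Rightarrow> 'g pset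
    \<Rightarrow> ('g point \<Rightarrow> 'g point) \<Rightarrow> 'g pset \<Rightarrow> 'g pset" where
  "dep_prod_gset G A q X f Y =
    (let P = {Tup y (encode_section (fibre X f y) s) |y s.
                y \<in> pts Y \<and> s \<in> fibre X f y \<rightarrow> pts A \<and> (\<forall>x\<in>fibre X f y. q (s x) = x)}
     in \<lparr>pts = P,
         act = (\<lambda>g. \<lambda>p\<in>P. Tup (act Y g (fst_pt p))
           (encode_section (fibre X f (act Y g (fst_pt p)))
             (\<lambda>x. act A g (apply_section (snd_pt p) (act X (inv\<^bsub>G\<^esub> g) x)))))\<rparr>)"

definition dep_prod_proj ::
  "('g, 'm) monoid_scheme \<Rightarrow> 'g pset \<Rightarrow> ('g point \<Rightarrow> 'g point) \<Rightarrow> 'g pset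
    \<Rightarrow> ('g point \<Rightarrow> 'g point) \<Rightarrow> 'g pset \<Rightarrow> 'g point \<Rightarrow> 'g point" where
  "dep_prod_proj G A q X f Y = restrict fst_pt (pts (dep_prod_gset G A q X f Y))"

definition dep_prod_eval ::
  "('g, 'm) monoid_scheme \<Rightarrow> 'g pset \<Rightarrow> ('g point \<Rightarrow> 'g point) \<Rightarrow> 'g pset
    \<Rightarrow> ('g point \<Rightarrow> 'g point) \<Rightarrow> 'g pset \<Rightarrow> 'g point \<Rightarrow> 'g point" where
  "dep_prod_eval G A q X f Y =
    (\<lambda>p\<in>pts (pullback_gset X f (dep_prod_gset G A q X f Y) (dep_prod_proj G A q X f Y)).
       apply_section (snd_pt (snd_pt p)) (fst_pt p))"


subsection \<open>Tambara functors\<close>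

text \<open>
  For \<open>f : X \<rightarrow> Y\<close>, the maps \<open>res X Y f : T(Y) \<rightarrow> T(X)\<close>, \<open>tr X Y f : T(X) \<rightarrow> T(Y)\<close> and
  \<open>nm X Y f : T(X) \<rightarrow> T(Y)\<close> are restriction, transfer and norm along \<open>f\<close>. Only their values on the
  carriers, and only at finite \<open>G\<close>-sets and \<open>G\<close>-maps, are meaningful.
\<close>

locale tambara_functor = group G for G :: "('g, 'm) monoid_scheme" (structure) +
  fixes T :: "'g pset \<Rightarrow> ('r, 'n) ring_scheme"
    and res tr nm :: "'g pset \<Rightarrow> 'g pset \<Rightarrow> ('g point \<Rightarrow> 'g point) \<Rightarrow> 'r \<Rightarrow> 'r"
  assumes cring: "fin_gset G X \<Longrightarrow> cring (T X)"
    and res_hom: "\<lbrakk>fin_gset G X; fin_gset G Y; f \<in> gmaps G X Y\<rbrakk>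
      \<Longrightarrow> res X Y f \<in> ring_hom (T Y) (T X)"
    and tr_hom: "\<lbrakk>fin_gset G X; fin_gset G Y; f \<in> gmaps G X Y\<rbrakk>
      \<Longrightarrow> tr X Y f \<in> hom (add_monoid (T X)) (add_monoid (T Y))"
    and nm_hom: "\<lbrakk>fin_gset G X; fin_gset G Y; f \<in> gmaps G X Y\<rbrakk>
      \<Longrightarrow> nm X Y f \<in> hom (T X) (T Y)"
    and nm_one: "\<lbrakk>fin_gset G X; fin_gset G Y; f \<in> gmaps G X Y\<rbrakk>
      \<Longrightarrow> nm X Y f \<one>\<^bsub>T X\<^esub> = \<one>\<^bsub>T Y\<^esub>"
    and res_id: "\<lbrakk>fin_gset G X; t \<in> carrier (T X)\<rbrakk> \<Longrightarrow> res X X (\<lambda>x\<in>pts X. x) t = t"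
    and tr_id: "\<lbrakk>fin_gset G X; t \<in> carrier (T X)\<rbrakk> \<Longrightarrow> tr X X (\<lambda>x\<in>pts X. x) t = t"
    and nm_id: "\<lbrakk>fin_gset G X; t \<in> carrier (T X)\<rbrakk> \<Longrightarrow> nm X X (\<lambda>x\<in>pts X. x) t = t"
    and res_compose: "\<lbrakk>fin_gset G X; fin_gset G Y; fin_gset G Z; f \<in> gmaps G X Y; g \<in> gmaps G Y Z;
        t \<in> carrier (T Z)\<rbrakk> \<Longrightarrow> res X Z (compose (pts X) g f) t = res X Y f (res Y Z g t)"
    and tr_compose: "\<lbrakk>fin_gset G X; fin_gset G Y; fin_gset G Z; f \<in> gmaps G X Y; g \<in> gmaps G Y Z;
        t \<in> carrier (T X)\<rbrakk> \<Longrightarrow> tr X Z (compose (pts X) g f) t = tr Y Z g (tr X Y f t)"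
    and nm_compose: "\<lbrakk>fin_gset G X; fin_gset G Y; fin_gset G Z; f \<in> gmaps G X Y; g \<in> gmaps G Y Z;
        t \<in> carrier (T X)\<rbrakk> \<Longrightarrow> nm X Z (compose (pts X) g f) t = nm Y Z g (nm X Y f t)"
    and empty: "\<lbrakk>fin_gset G X; pts X = {}\<rbrakk> \<Longrightarrow> carrier (T X) = {\<zero>\<^bsub>T X\<^esub>}"
    and coprod: "\<lbrakk>fin_gset G X; fin_gset G Y\<rbrakk> \<Longrightarrow>
        (\<lambda>t. (res X (coprod_gset X Y) (inj1 X) t, res Y (coprod_gset X Y) (inj2 Y) t))
          \<in> ring_iso (T (coprod_gset X Y)) (RDirProd (T X) (T Y))"
    and res_tr: "\<lbrakk>fin_gset G X; fin_gset G Y; fin_gset G Y'; f \<in> gmaps G X Y; g \<in> gmaps G Y' Y;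
        t \<in> carrier (T X)\<rbrakk> \<Longrightarrow>
        res Y' Y g (tr X Y f t) =
        tr (pullback_gset X f Y' g) Y' (pullback_snd X f Y' g)
          (res (pullback_gset X f Y' g) X (pullback_fst X f Y' g) t)"
    and res_nm: "\<lbrakk>fin_gset G X; fin_gset G Y; fin_gset G Y'; f \<in> gmaps G X Y; g \<in> gmaps G Y' Y;
        t \<in> carrier (T X)\<rbrakk> \<Longrightarrow>
        res Y' Y g (nm X Y f t) =
        nm (pullback_gset X f Y' g) Y' (pullback_snd X f Y' g)
          (res (pullback_gset X f Y' g) X (pullback_fst X f Y' g) t)"
    and nm_tr: "\<lbrakk>fin_gset G A; fin_gset G X; fin_gset G Y; q \<in> gmaps G A X; f \<in> gmaps G X Y;
        t \<in> carrier (T A);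
        D = dep_prod_gset G A q X f Y; p = dep_prod_proj G A q X f Y;
        E = pullback_gset X f D p; r = pullback_snd X f D p; e = dep_prod_eval G A q X f Y\<rbrakk> \<Longrightarrow>
        nm X Y f (tr A X q t) = tr D Y p (nm E D r (res E A e t))"

definition res_sub ::
  "('g, 'm) monoid_scheme
    \<Rightarrow> ('g pset \<Rightarrow> 'g pset \<Rightarrow> ('g point \<Rightarrow> 'g point) \<Rightarrow> 'r \<Rightarrow> 'r) \<Rightarrow> 'g set \<Rightarrow> 'g set \<Rightarrow> 'r \<Rightarrow> 'r" where
  "res_sub G res K H = res (orbit_gset G H) (orbit_gset G K) (orbit_proj G H K)"

definition tr_sub ::
  "('g, 'm) monoid_scheme
    \<Rightarrow> ('g pset \<Rightarrow> 'g pset \<Rightarrow> ('g point \<Rightarrow> 'g point) \<Rightarrow> 'r \<Rightarrow> 'r) \<Rightarrow> 'g set \<Rightarrow> 'g set \<Rightarrow> 'r \<Rightarrow> 'r" where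
  "tr_sub G tr K H = tr (orbit_gset G H) (orbit_gset G K) (orbit_proj G H K)"

definition nm_sub ::
  "('g, 'm) monoid_scheme
    \<Rightarrow> ('g pset \<Rightarrow> 'g pset \<Rightarrow> ('g point \<Rightarrow> 'g point) \<Rightarrow> 'r \<Rightarrow> 'r) \<Rightarrow> 'g set \<Rightarrow> 'g set \<Rightarrow> 'r \<Rightarrow> 'r" where
  "nm_sub G nm K H = nm (orbit_gset G H) (orbit_gset G K) (orbit_proj G H K)"

definition sub_index :: "('g, 'm) monoid_scheme \<Rightarrow> 'g set \<Rightarrow> 'g set \<Rightarrow> nat" where
  "sub_index G K H = card (lcosets\<^bsub>G\<lparr>carrier := K\<rparr>\<^esub> H)"

definition additively_cohomological ::
  "('g, 'm) monoid_scheme \<Rightarrow> ('g pset \<Rightarrow> ('r, 'n) ring_scheme)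
    \<Rightarrow> ('g pset \<Rightarrow> 'g pset \<Rightarrow> ('g point \<Rightarrow> 'g point) \<Rightarrow> 'r \<Rightarrow> 'r)
    \<Rightarrow> ('g pset \<Rightarrow> 'g pset \<Rightarrow> ('g point \<Rightarrow> 'g point) \<Rightarrow> 'r \<Rightarrow> 'r) \<Rightarrow> bool" where
  "additively_cohomological G T res tr \<longleftrightarrow>
    (\<forall>H K. subgroup H G \<and> subgroup K G \<and> H \<subseteq> K \<longrightarrow>
      (\<forall>t\<in>carrier (T (orbit_gset G K)).
        tr_sub G tr K H (res_sub G res K H t) = [sub_index G K H] \<cdot>\<^bsub>T (orbit_gset G K)\<^esub> t))"

definition multiplicatively_cohomological ::
  "('g, 'm) monoid_scheme \<Rightarrow> ('g pset \<Rightarrow> ('r, 'n) ring_scheme)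
    \<Rightarrow> ('g pset \<Rightarrow> 'g pset \<Rightarrow> ('g point \<Rightarrow> 'g point) \<Rightarrow> 'r \<Rightarrow> 'r)
    \<Rightarrow> ('g pset \<Rightarrow> 'g pset \<Rightarrow> ('g point \<Rightarrow> 'g point) \<Rightarrow> 'r \<Rightarrow> 'r) \<Rightarrow> bool" where
  "multiplicatively_cohomological G T res nm \<longleftrightarrow>
    (\<forall>H K. subgroup H G \<and> subgroup K G \<and> H \<subseteq> K \<longrightarrow>
      (\<forall>t\<in>carrier (T (orbit_gset G K)).
        nm_sub G nm K H (res_sub G res K H t) = t [^]\<^bsub>T (orbit_gset G K)\<^esub> sub_index G K H))"

end

theory Submission
  imports Defs
begin

text \<open>
  By Frobenius reciprocity \<open>tr(res t) = t \<cdot> tr 1\<close>, so the claim is that \<open>x = tr\<^sup>K\<^sub>H 1\<close> equals the integer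
  \<open>n = |K/H|\<close>. By induction on \<open>K\<close> and transitivity of transfers one may take \<open>H\<close> maximal in \<open>K\<close> and assume
  that over every proper subgroup \<open>L\<close> of \<open>K\<close> a transfer of one is the number of points of the fibre.
  Then \<open>x\<^sup>2 = n x\<close> and \<open>n tr\<^sup>K\<^sub>L 1 = x tr\<^sup>K\<^sub>L 1 = |K/L| x\<close> for \<open>L \<noteq> K\<close>.
  The norm of \<open>res x\<close> is the transfer of one from the \<open>K\<close>-set of all maps \<open>K/H \<rightarrow> K/H\<close>; by hypothesis it
  equals \<open>x\<^sup>n = n\<^bsup>n-1\<^esup> x\<close>. The fixed points of this \<open>K\<close>-set are the equivariant maps.
  If \<open>H\<close> is self-normalizing, there is just one of them, and multiplying by \<open>n\<close> gives
  \<open>n\<^sup>n x = n + (n\<^sup>n - 1) x\<close>. If \<open>H\<close> is normal, there are \<open>n\<close> of them and all other orbits are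
  \<open>K/H\<close>, which gives \<open>n\<^bsup>n-1\<^esup> x = n + (n\<^bsup>n-1\<^esup> - 1) x\<close>. In both cases \<open>x = n\<close>.
\<close>

section \<open>Finite group sets\<close>

text \<open>The ring \<open>T(G/K)\<close> may have torsion, so nothing may be divided by
  \<open>n\<close> there. Each case is arranged so that the coefficients of \<open>x\<close> on the
  two sides differ by exactly one; all copies of \<open>x\<close> but one then cancel in the
  additive group. In the self-normalizing case only \<open>n\<close> times the transfer of one from
  \<open>L\<close> is known to be a multiple of \<open>x\<close>, not that transfer itself; hence
  the extra factor \<open>n\<close>. In the normal case every stabilizer contains \<open>H\<close>,
  so by maximality it is \<open>H\<close> or \<open>K\<close>. Maximality is also what leaves just
  these two cases, since the normalizer of \<open>H\<close> in \<open>K\<close> lies between them.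
  The chain for \<open>L\<close> reads one product in two ways: by reciprocity either
  \<open>x\<close> is restricted to \<open>L\<close>, or the transfer from \<open>L\<close> is
  restricted to \<open>H\<close>. Both restrictions are transfers of one over proper subgroups,
  taken from pullbacks that need not be orbits; the induction therefore speaks of all finite
  \<open>G\<close>-sets over \<open>G/L\<close>. Frobenius reciprocity is not an axiom here. It is
  extracted from the law for a norm of a transfer.\<close>

context group
begin

text \<open>\<open>group_action\<close> asks for a homomorphism into \<open>BijGroup\<close>, whose
  elements are extensional; hence the last assumption. Bijectivity holds because the action of
  \<open>inv g\<close> inverts that of \<open>g\<close>.\<close>

lemma fin_gsetI:
  assumes "finite (pts X)"
    and "\<And>g x. g \<in> carrier G \<Longrightarrow> x \<in> pts X \<Longrightarrow> act X g x \<in> pts X"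
    and "\<And>x. x \<in> pts X \<Longrightarrow> act X \<one> x = x"
    and "\<And>g h x. g \<in> carrier G \<Longrightarrow> h \<in> carrier G \<Longrightarrow> x \<in> pts X \<Longrightarrow>
      act X (g \<otimes> h) x = act X g (act X h x)"
    and "\<And>g. g \<in> carrier G \<Longrightarrow> act X g \<in> extensional (pts X)"
  shows "fin_gset G X"
proof -
  have inv1: "act X (inv g) (act X g x) = x" "act X g (act X (inv g) x) = x"
    if "g \<in> carrier G" "x \<in> pts X" for g x
    using that assms(3) assms(4)[of "inv g" g x] assms(4)[of g "inv g" x] by auto
  have bij: "act X g \<in> Bij (pts X)" if g: "g \<in> carrier G" for g
  proof -
    have "bij_betw (act X g) (pts X) (pts X)"
      by (rule bij_betw_byWitness[where f' = "act X (inv g)"]) (use g inv1 assms(2) in auto)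
    then show ?thesis
      using assms(5)[OF g] by (simp add: Bij_def)
  qed
  have "act X (g \<otimes> h) = compose (pts X) (act X g) (act X h)"
    if "g \<in> carrier G" "h \<in> carrier G" for g h
    by (rule extensionalityI[where A = "pts X"])
      (use that assms(4,5) in \<open>auto simp: compose_def\<close>)
  then have "act X \<in> hom G (BijGroup (pts X))"
    using bij by (auto simp: hom_def BijGroup_def)
  then have "group_action G (pts X) (act X)"
    by (simp add: group_action_def group_hom_def group_hom_axioms_def group_axioms group_BijGroup)
  with assms(1) show ?thesis
    by (simp add: fin_gset_def)
qed

lemma fin_gset_finite: "fin_gset G X \<Longrightarrow> finite (pts X)"
  by (simp add: fin_gset_def)

lemma act_closed: "\<lbrakk>fin_gset G X; g \<in> carrier G; x \<in> pts X\<rbrakk> \<Longrightarrow> act X g x \<in> pts X"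
  by (meson fin_gset_def group_action.element_image)

lemma act_one: "\<lbrakk>fin_gset G X; x \<in> pts X\<rbrakk> \<Longrightarrow> act X \<one> x = x"
  by (metis fin_gset_def group_action.id_eq_one restrict_apply')

lemma act_mult:
  "\<lbrakk>fin_gset G X; g \<in> carrier G; h \<in> carrier G; x \<in> pts X\<rbrakk> \<Longrightarrow>
    act X (g \<otimes> h) x = act X g (act X h x)"
  unfolding fin_gset_def by (meson group_action.composition_rule)

lemma act_inv:
  assumes "fin_gset G X" "g \<in> carrier G" "x \<in> pts X"
  shows "act X (inv g) (act X g x) = x" "act X g (act X (inv g) x) = x"
  using assms act_mult[of X "inv g" g x] act_mult[of X g "inv g" x] act_one[of X x] by auto

lemma gmapsI:
  assumes "f \<in> extensional (pts X)" "\<And>x. x \<in> pts X \<Longrightarrow> f x \<in> pts Y"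
    and "\<And>g x. g \<in> carrier G \<Longrightarrow> x \<in> pts X \<Longrightarrow> f (act X g x) = act Y g (f x)"
  shows "f \<in> gmaps G X Y"
  using assms by (auto simp: gmaps_def PiE_def)

lemma gmaps_closed: "f \<in> gmaps G X Y \<Longrightarrow> x \<in> pts X \<Longrightarrow> f x \<in> pts Y"
  by (auto simp: gmaps_def)

lemma gmaps_act: "f \<in> gmaps G X Y \<Longrightarrow> g \<in> carrier G \<Longrightarrow> x \<in> pts X \<Longrightarrow> f (act X g x) = act Y g (f x)"
  by (auto simp: gmaps_def)

lemma gmaps_extensional: "f \<in> gmaps G X Y \<Longrightarrow> f \<in> extensional (pts X)"
  by (simp add: gmaps_def PiE_def)

lemma gmaps_eqI:
  assumes "f \<in> gmaps G X Y" "f' \<in> gmaps G X Y" "\<And>x. x \<in> pts X \<Longrightarrow> f x = f' x"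
  shows "f = f'"
  using assms extensionalityI gmaps_extensional by blast

lemma compose_gmaps:
  assumes "fin_gset G X" "f \<in> gmaps G X Y" "g \<in> gmaps G Y Z"
  shows "compose (pts X) g f \<in> gmaps G X Z"
  using assms by (intro gmapsI) (auto simp: compose_eq gmaps_closed gmaps_act act_closed)

lemma id_gmaps: "fin_gset G X \<Longrightarrow> (\<lambda>x\<in>pts X. x) \<in> gmaps G X X"
  by (intro gmapsI) (auto simp: act_closed)

lemma restrict_gmaps:
  assumes "fin_gset G X" "\<And>x. x \<in> pts X \<Longrightarrow> f x \<in> pts Y"
    and "\<And>g x. g \<in> carrier G \<Longrightarrow> x \<in> pts X \<Longrightarrow> f (act X g x) = act Y g (f x)"
  shows "restrict f (pts X) \<in> gmaps G X Y"
  using assms by (intro gmapsI) (auto simp: act_closed)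

lemma inverse_gmaps:
  assumes X: "fin_gset G X" and Y: "fin_gset G Y" and f: "f \<in> gmaps G X Y"
    and bij: "bij_betw f (pts X) (pts Y)"
  obtains f' where "f' \<in> gmaps G Y X" "bij_betw f' (pts Y) (pts X)"
    "\<And>x. x \<in> pts X \<Longrightarrow> f' (f x) = x" "\<And>y. y \<in> pts Y \<Longrightarrow> f (f' y) = y"
proof
  let ?f' = "restrict (the_inv_into (pts X) f) (pts Y)"
  have inj: "inj_on f (pts X)" and im: "f ` pts X = pts Y"
    using bij by (auto simp: bij_betw_def)
  show 1: "?f' (f x) = x" if "x \<in> pts X" for x
    using that inj im by (auto simp: the_inv_into_f_f)
  show 2: "f (?f' y) = y" if "y \<in> pts Y" for y
    using that inj im by (auto simp: f_the_inv_into_f)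
  have 3: "?f' y \<in> pts X" if "y \<in> pts Y" for y
    using that inj im by (auto simp: the_inv_into_into)
  show "?f' \<in> gmaps G Y X"
  proof (intro gmapsI)
    fix g y assume gy: "g \<in> carrier G" "y \<in> pts Y"
    have "?f' (act Y g y) = ?f' (f (act X g (?f' y)))"
      using gy 2 3 gmaps_act[OF f] by metis
    then show "?f' (act Y g y) = act X g (?f' y)"
      using gy 1 3 act_closed[OF X] by metis
  qed (use 3 in auto)
  show "bij_betw ?f' (pts Y) (pts X)"
    by (rule bij_betw_byWitness[where f' = f]) (use 1 2 3 im in auto)
qed

subsection \<open>Invariant subsets\<close>

definition sub_gset :: "('g, 'x) gset \<Rightarrow> 'x set \<Rightarrow> ('g, 'x) gset" where
  "sub_gset X S = \<lparr>pts = S, act = (\<lambda>g. restrict (act X g) S)\<rparr>"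

lemma pts_sub_gset [simp]: "pts (sub_gset X S) = S"
  by (simp add: sub_gset_def)

lemma act_sub_gset [simp]: "x \<in> S \<Longrightarrow> act (sub_gset X S) g x = act X g x"
  by (simp add: sub_gset_def)

lemma fin_gset_sub_gset:
  assumes "fin_gset G X" "S \<subseteq> pts X" "\<And>g x. g \<in> carrier G \<Longrightarrow> x \<in> S \<Longrightarrow> act X g x \<in> S"
  shows "fin_gset G (sub_gset X S)"
  using assms finite_subset[OF assms(2) fin_gset_finite[OF assms(1)]]
  by (intro fin_gsetI) (auto simp: act_one act_mult subset_iff, auto simp: sub_gset_def)

lemma incl_gmaps:
  assumes "fin_gset G X" "S \<subseteq> pts X" "\<And>g x. g \<in> carrier G \<Longrightarrow> x \<in> S \<Longrightarrow> act X g x \<in> S"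
  shows "(\<lambda>x\<in>S. x) \<in> gmaps G (sub_gset X S) X"
  using assms by (intro gmapsI) auto

subsection \<open>Coproducts and pullbacks\<close>

lemma pts_coprod [simp]: "pts (coprod_gset X Y) = In1 ` pts X \<union> In2 ` pts Y"
  by (simp add: coprod_gset_def)

lemma act_coprod [simp]:
  "x \<in> pts X \<Longrightarrow> act (coprod_gset X Y) g (In1 x) = In1 (act X g x)"
  "y \<in> pts Y \<Longrightarrow> act (coprod_gset X Y) g (In2 y) = In2 (act Y g y)"
  by (auto simp: coprod_gset_def)

lemma fin_gset_coprod:
  assumes "fin_gset G X" "fin_gset G Y"
  shows "fin_gset G (coprod_gset X Y)"
  using assms
  by (intro fin_gsetI) (auto simp: act_closed act_one act_mult fin_gset_finite, auto simp: coprod_gset_def)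

lemma inj1_gmaps: "fin_gset G X \<Longrightarrow> inj1 X \<in> gmaps G X (coprod_gset X Y)"
  unfolding inj1_def by (rule restrict_gmaps) auto

lemma inj2_gmaps: "fin_gset G Y \<Longrightarrow> inj2 Y \<in> gmaps G Y (coprod_gset X Y)"
  unfolding inj2_def by (rule restrict_gmaps) auto

definition copair :: "'h pset \<Rightarrow> 'h pset \<Rightarrow> ('h point \<Rightarrow> 'x) \<Rightarrow> ('h point \<Rightarrow> 'x) \<Rightarrow> 'h point \<Rightarrow> 'x" where
  "copair X Y u v = (\<lambda>p\<in>pts (coprod_gset X Y). case p of In1 x \<Rightarrow> u x | In2 y \<Rightarrow> v y)"

lemma copair_simps [simp]:
  "x \<in> pts X \<Longrightarrow> copair X Y u v (In1 x) = u x"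
  "y \<in> pts Y \<Longrightarrow> copair X Y u v (In2 y) = v y"
  by (auto simp: copair_def)

lemma copair_gmaps:
  assumes "fin_gset G X" "fin_gset G Y" "u \<in> gmaps G X Z" "v \<in> gmaps G Y Z"
  shows "copair X Y u v \<in> gmaps G (coprod_gset X Y) Z"
  unfolding copair_def
  by (rule restrict_gmaps[OF fin_gset_coprod[OF assms(1,2)]])
    (use assms in \<open>auto simp: gmaps_closed gmaps_act\<close>)

lemma pts_pullback: "pts (pullback_gset X f Y' g) = {Tup x y |x y. x \<in> pts X \<and> y \<in> pts Y' \<and> f x = g y}"
  by (simp add: pullback_gset_def Let_def)

lemma Tup_pullback [simp]:
  "Tup x y \<in> pts (pullback_gset X f Y' g) \<longleftrightarrow> x \<in> pts X \<and> y \<in> pts Y' \<and> f x = g y"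
  by (auto simp: pts_pullback)

lemma act_pullback [simp]:
  "\<lbrakk>x \<in> pts X; y \<in> pts Y'; f x = g y\<rbrakk> \<Longrightarrow>
    act (pullback_gset X f Y' g) a (Tup x y) = Tup (act X a x) (act Y' a y)"
  by (auto simp: pullback_gset_def Let_def)

lemma pullback_cases:
  assumes "z \<in> pts (pullback_gset X f Y' g)"
  obtains x y where "z = Tup x y" "x \<in> pts X" "y \<in> pts Y'" "f x = g y"
  using assms by (auto simp: pts_pullback)

lemma pullback_fst_Tup [simp]:
  "\<lbrakk>x \<in> pts X; y \<in> pts Y'; f x = g y\<rbrakk> \<Longrightarrow> pullback_fst X f Y' g (Tup x y) = x"
  by (auto simp: pullback_fst_def)

lemma pullback_snd_Tup [simp]:
  "\<lbrakk>x \<in> pts X; y \<in> pts Y'; f x = g y\<rbrakk> \<Longrightarrow> pullback_snd X f Y' g (Tup x y) = y"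
  by (auto simp: pullback_snd_def)

lemma fin_gset_pullback:
  assumes "fin_gset G X" "fin_gset G Y'" "f \<in> gmaps G X Y" "g \<in> gmaps G Y' Y"
  shows "fin_gset G (pullback_gset X f Y' g)"
proof (rule fin_gsetI)
  have "pts (pullback_gset X f Y' g) \<subseteq> (\<lambda>(x, y). Tup x y) ` (pts X \<times> pts Y')"
    by (auto simp: pts_pullback)
  then show "finite (pts (pullback_gset X f Y' g))"
    using assms by (meson fin_gset_finite finite_SigmaI finite_imageI finite_subset)
  show "act (pullback_gset X f Y' g) a \<in> extensional (pts (pullback_gset X f Y' g))" for a
    by (simp add: pullback_gset_def Let_def)
qed (use assms in \<open>auto simp: pts_pullback act_closed act_one act_mult gmaps_act\<close>)

lemma pullback_fst_gmaps:
  assumes "fin_gset G X" "fin_gset G Y'" "f \<in> gmaps G X Y" "g \<in> gmaps G Y' Y"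
  shows "pullback_fst X f Y' g \<in> gmaps G (pullback_gset X f Y' g) X"
  unfolding pullback_fst_def
  by (rule restrict_gmaps[OF fin_gset_pullback[OF assms]]) (auto elim!: pullback_cases)

lemma pullback_snd_gmaps:
  assumes "fin_gset G X" "fin_gset G Y'" "f \<in> gmaps G X Y" "g \<in> gmaps G Y' Y"
  shows "pullback_snd X f Y' g \<in> gmaps G (pullback_gset X f Y' g) Y'"
  unfolding pullback_snd_def
  by (rule restrict_gmaps[OF fin_gset_pullback[OF assms]]) (auto elim!: pullback_cases)

text \<open>Base change does not alter fibres; this is how a point count over one orbit is carried
  to another.\<close>

lemma fibre_pullback_snd:
  assumes "y \<in> pts Y'"
  shows "fibre (pullback_gset X f Y' g) (pullback_snd X f Y' g) y = (\<lambda>x. Tup x y) ` fibre X f (g y)"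
  using assms by (auto simp: fibre_def elim!: pullback_cases)

lemma card_fibre_pullback_snd:
  assumes "y \<in> pts Y'"
  shows "card (fibre (pullback_gset X f Y' g) (pullback_snd X f Y' g) y) = card (fibre X f (g y))"
  unfolding fibre_pullback_snd[OF assms] by (rule card_image) (auto simp: inj_on_def)

end

section \<open>Restriction, transfer and norm along isomorphisms and inclusions\<close>

text \<open>A disjoint union presented by two embeddings. The axiom \<open>coprod\<close> concerns
  only the tagged union built from \<open>In1\<close> and \<open>In2\<close>; this form also fits an
  orbit and its complement inside a \<open>G\<close>-set.\<close>

definition (in group) decomposition ::
  "('a, 'x) gset \<Rightarrow> ('x \<Rightarrow> 'z) \<Rightarrow> ('a, 'y) gset \<Rightarrow> ('y \<Rightarrow> 'z) \<Rightarrow> ('a, 'z) gset \<Rightarrow> bool" where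
  "decomposition X i Y j A \<longleftrightarrow>
    fin_gset G X \<and> fin_gset G Y \<and> fin_gset G A \<and> i \<in> gmaps G X A \<and> j \<in> gmaps G Y A \<and>
    inj_on i (pts X) \<and> inj_on j (pts Y) \<and>
    i ` pts X \<inter> j ` pts Y = {} \<and> i ` pts X \<union> j ` pts Y = pts A"

lemma (in group) decomposition_coprod:
  assumes "fin_gset G X" "fin_gset G Y"
  shows "decomposition X (inj1 X) Y (inj2 Y) (coprod_gset X Y)"
proof -
  have "inj1 X ` pts X = In1 ` pts X" "inj2 Y ` pts Y = In2 ` pts Y"
    by (auto simp: inj1_def inj2_def)
  moreover have "inj_on (inj1 X) (pts X)" "inj_on (inj2 Y) (pts Y)"
    by (auto simp: inj1_def inj2_def inj_on_def)
  ultimately show ?thesis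
    unfolding decomposition_def
    using assms fin_gset_coprod[OF assms] inj1_gmaps[OF assms(1)] inj2_gmaps[OF assms(2)]
    by (intro conjI) auto
qed

context tambara_functor
begin

lemma res_closed:
  "\<lbrakk>fin_gset G X; fin_gset G Y; f \<in> gmaps G X Y; t \<in> carrier (T Y)\<rbrakk> \<Longrightarrow> res X Y f t \<in> carrier (T X)"
  by (rule ring_hom_closed[OF res_hom])

lemma tr_closed:
  "\<lbrakk>fin_gset G X; fin_gset G Y; f \<in> gmaps G X Y; t \<in> carrier (T X)\<rbrakk> \<Longrightarrow> tr X Y f t \<in> carrier (T Y)"
  using hom_in_carrier[OF tr_hom] by fastforce

lemma nm_closed:
  "\<lbrakk>fin_gset G X; fin_gset G Y; f \<in> gmaps G X Y; t \<in> carrier (T X)\<rbrakk> \<Longrightarrow> nm X Y f t \<in> carrier (T Y)"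
  using hom_in_carrier[OF nm_hom] by fastforce

lemma res_one:
  "\<lbrakk>fin_gset G X; fin_gset G Y; f \<in> gmaps G X Y\<rbrakk> \<Longrightarrow> res X Y f \<one>\<^bsub>T Y\<^esub> = \<one>\<^bsub>T X\<^esub>"
  by (rule ring_hom_one[OF res_hom])

lemma res_mult:
  "\<lbrakk>fin_gset G X; fin_gset G Y; f \<in> gmaps G X Y; s \<in> carrier (T Y); t \<in> carrier (T Y)\<rbrakk> \<Longrightarrow>
    res X Y f (s \<otimes>\<^bsub>T Y\<^esub> t) = res X Y f s \<otimes>\<^bsub>T X\<^esub> res X Y f t"
  by (rule ring_hom_mult[OF res_hom])

lemma res_add:
  "\<lbrakk>fin_gset G X; fin_gset G Y; f \<in> gmaps G X Y; s \<in> carrier (T Y); t \<in> carrier (T Y)\<rbrakk> \<Longrightarrow>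
    res X Y f (s \<oplus>\<^bsub>T Y\<^esub> t) = res X Y f s \<oplus>\<^bsub>T X\<^esub> res X Y f t"
  by (rule ring_hom_add[OF res_hom])

lemma tr_add:
  "\<lbrakk>fin_gset G X; fin_gset G Y; f \<in> gmaps G X Y; s \<in> carrier (T X); t \<in> carrier (T X)\<rbrakk> \<Longrightarrow>
    tr X Y f (s \<oplus>\<^bsub>T X\<^esub> t) = tr X Y f s \<oplus>\<^bsub>T Y\<^esub> tr X Y f t"
  using hom_mult[OF tr_hom] by fastforce

lemma nm_mult:
  "\<lbrakk>fin_gset G X; fin_gset G Y; f \<in> gmaps G X Y; s \<in> carrier (T X); t \<in> carrier (T X)\<rbrakk> \<Longrightarrow>
    nm X Y f (s \<otimes>\<^bsub>T X\<^esub> t) = nm X Y f s \<otimes>\<^bsub>T Y\<^esub> nm X Y f t"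
  using hom_mult[OF nm_hom] by fastforce

lemma one_closed_T: "fin_gset G X \<Longrightarrow> \<one>\<^bsub>T X\<^esub> \<in> carrier (T X)"
  using cring.cring_simprules(6)[OF cring] .

lemma tr_zero:
  assumes "fin_gset G X" "fin_gset G Y" "f \<in> gmaps G X Y"
  shows "tr X Y f \<zero>\<^bsub>T X\<^esub> = \<zero>\<^bsub>T Y\<^esub>"
proof -
  interpret RX: cring "T X" using cring assms(1) .
  interpret RY: cring "T Y" using cring assms(2) .
  have "group_hom (add_monoid (T X)) (add_monoid (T Y)) (tr X Y f)"
    by (simp add: group_hom_def group_hom_axioms_def RX.a_group RY.a_group tr_hom[OF assms])
  from group_hom.hom_one[OF this] show ?thesis
    by simp
qed

text \<open>Both sides are computed by the same pullback, once as the fibre product of \<open>id\<close> and \<open>f\<close>, once as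
  that of \<open>f'\<close> and \<open>id\<close>.\<close>

lemma res_iso_eq:
  assumes X: "fin_gset G X" and Y: "fin_gset G Y" and f: "f \<in> gmaps G X Y" and f': "f' \<in> gmaps G Y X"
    and "\<And>x. x \<in> pts X \<Longrightarrow> f' (f x) = x" "\<And>y. y \<in> pts Y \<Longrightarrow> f (f' y) = y" and t: "t \<in> carrier (T Y)"
  shows res_iso_eq_tr: "res X Y f t = tr Y X f' t" and res_iso_eq_nm: "res X Y f t = nm Y X f' t"
proof -
  let ?iX = "\<lambda>x\<in>pts X. x" and ?iY = "\<lambda>x\<in>pts Y. x"
  let ?P = "pullback_gset Y ?iY X f"
  have "{Tup y x |y x. y \<in> pts Y \<and> x \<in> pts X \<and> ?iY y = f x} =
      {Tup y x |y x. y \<in> pts Y \<and> x \<in> pts X \<and> f' y = ?iX x}"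
    using assms(5,6) by auto
  then have P: "?P = pullback_gset Y f' X ?iX"
    unfolding pullback_gset_def by simp
  have fst: "pullback_fst Y ?iY X f = pullback_fst Y f' X ?iX"
    and snd: "pullback_snd Y ?iY X f = pullback_snd Y f' X ?iX"
    by (simp_all add: pullback_fst_def pullback_snd_def P)
  note iX = id_gmaps[OF X] and iY = id_gmaps[OF Y]
  show "res X Y f t = tr Y X f' t"
    using res_tr[OF Y Y X iY f t] res_tr[OF Y X X f' iX t] tr_id[OF Y t]
      res_id[OF X tr_closed[OF Y X f' t]] by (simp add: P fst snd)
  show "res X Y f t = nm Y X f' t"
    using res_nm[OF Y Y X iY f t] res_nm[OF Y X X f' iX t] nm_id[OF Y t]
      res_id[OF X nm_closed[OF Y X f' t]] by (simp add: P fst snd)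
qed

text \<open>Restriction along an isomorphism is both the transfer and the norm along its inverse, so
  the two composites are a transfer and a norm along an identity.\<close>

lemma iso_res:
  assumes X: "fin_gset G X" and Y: "fin_gset G Y" and f: "f \<in> gmaps G X Y"
    and bij: "bij_betw f (pts X) (pts Y)" and t: "t \<in> carrier (T Y)"
  shows tr_iso_res: "tr X Y f (res X Y f t) = t" and nm_iso_res: "nm X Y f (res X Y f t) = t"
proof -
  obtain f' where f': "f' \<in> gmaps G Y X" "\<And>x. x \<in> pts X \<Longrightarrow> f' (f x) = x"
    "\<And>y. y \<in> pts Y \<Longrightarrow> f (f' y) = y"
    using inverse_gmaps[OF X Y f bij] by metis
  have "compose (pts Y) f f' = (\<lambda>y\<in>pts Y. y)"
    using f' by (auto simp: compose_def)
  then show "tr X Y f (res X Y f t) = t" "nm X Y f (res X Y f t) = t"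
    using res_iso_eq[OF X Y f f'(1) f'(2,3) t] tr_compose[OF Y X Y f'(1) f t] tr_id[OF Y t]
      nm_compose[OF Y X Y f'(1) f t] nm_id[OF Y t] by simp_all
qed

lemma res_iso_inj:
  assumes X: "fin_gset G X" and Y: "fin_gset G Y" and f: "f \<in> gmaps G X Y"
    and bij: "bij_betw f (pts X) (pts Y)" and "s \<in> carrier (T Y)" "t \<in> carrier (T Y)"
    and "res X Y f s = res X Y f t"
  shows "s = t"
  using tr_iso_res[OF X Y f bij] assms(5-7) by metis

text \<open>The pullback of an injection along itself is the diagonal, so its two projections agree
  and are isomorphisms; base change reduces both claims to \<open>iso_res\<close>.\<close>

lemma res_inj:
  assumes X: "fin_gset G X" and A: "fin_gset G A" and i: "i \<in> gmaps G X A"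
    and inj: "inj_on i (pts X)" and t: "t \<in> carrier (T X)"
  shows res_tr_inj: "res X A i (tr X A i t) = t" and res_nm_inj: "res X A i (nm X A i t) = t"
proof -
  let ?P = "pullback_gset X i X i" and ?\<pi> = "pullback_fst X i X i"
  have eq: "pullback_snd X i X i = ?\<pi>"
    unfolding pullback_fst_def pullback_snd_def
    by (rule restrict_ext) (auto elim!: pullback_cases simp: inj_on_eq_iff[OF inj])
  have bij: "bij_betw ?\<pi> (pts ?P) (pts X)"
    by (rule bij_betw_byWitness[where f' = "\<lambda>x. Tup x x"])
      (auto elim!: pullback_cases simp: inj_on_eq_iff[OF inj])
  note P = fin_gset_pullback[OF X X i i] pullback_fst_gmaps[OF X X i i]
  show "res X A i (tr X A i t) = t"
    using res_tr[OF X A X i i t] tr_iso_res[OF P(1) X P(2) bij t] by (simp add: eq)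
  show "res X A i (nm X A i t) = t"
    using res_nm[OF X A X i i t] nm_iso_res[OF P(1) X P(2) bij t] by (simp add: eq)
qed

text \<open>Base change passes through an empty pullback, whose ring is zero, so that 0 = 1 there.
  Transfer sends this element to 0, norm sends it to 1.\<close>

lemma res_disjoint:
  assumes X: "fin_gset G X" and Y: "fin_gset G Y" and A: "fin_gset G A"
    and i: "i \<in> gmaps G X A" and j: "j \<in> gmaps G Y A"
    and disj: "i ` pts X \<inter> j ` pts Y = {}" and t: "t \<in> carrier (T X)"
  shows res_tr_disjoint: "res Y A j (tr X A i t) = \<zero>\<^bsub>T Y\<^esub>"
    and res_nm_disjoint: "res Y A j (nm X A i t) = \<one>\<^bsub>T Y\<^esub>"
proof -
  let ?P = "pullback_gset X i Y j"
  let ?u = "res ?P X (pullback_fst X i Y j) t"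
  note P = fin_gset_pullback[OF X Y i j] pullback_fst_gmaps[OF X Y i j] pullback_snd_gmaps[OF X Y i j]
  have "pts ?P = {}"
    using disj by (auto simp: pts_pullback)
  then have carr: "carrier (T ?P) = {\<zero>\<^bsub>T ?P\<^esub>}"
    using empty[OF P(1)] by simp
  then have u: "?u = \<zero>\<^bsub>T ?P\<^esub>" and one: "\<one>\<^bsub>T ?P\<^esub> = \<zero>\<^bsub>T ?P\<^esub>"
    using res_closed[OF P(1) X P(2) t] one_closed_T[OF P(1)] by auto
  show "res Y A j (tr X A i t) = \<zero>\<^bsub>T Y\<^esub>"
    using res_tr[OF X A Y i j t] tr_zero[OF P(1) Y P(3)] u by simp
  show "res Y A j (nm X A i t) = \<one>\<^bsub>T Y\<^esub>"
    using res_nm[OF X A Y i j t] nm_one[OF P(1) Y P(3)] u one by simp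
qed

text \<open>The two maps glue to an isomorphism from the formal coproduct, where by
  \<open>coprod\<close> an element is determined by its two restrictions.\<close>

lemma decomposition_eqI:
  assumes d: "decomposition X i Y j A" and s: "s \<in> carrier (T A)" and t: "t \<in> carrier (T A)"
    and "res X A i s = res X A i t" "res Y A j s = res Y A j t"
  shows "s = t"
proof -
  have X: "fin_gset G X" and Y: "fin_gset G Y" and A: "fin_gset G A" and i: "i \<in> gmaps G X A"
    and j: "j \<in> gmaps G Y A"
    using d by (auto simp: decomposition_def)
  let ?C = "coprod_gset X Y" and ?\<phi> = "copair X Y i j"
  have C: "fin_gset G ?C" and \<phi>: "?\<phi> \<in> gmaps G ?C A"
    using fin_gset_coprod copair_gmaps X Y i j by auto
  have bij: "bij_betw ?\<phi> (pts ?C) (pts A)"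
  proof -
    have "?\<phi> ` pts ?C = i ` pts X \<union> j ` pts Y"
      by (simp add: image_Un image_image)
    moreover have "inj_on ?\<phi> (pts ?C)"
    proof (rule inj_onI)
      have inj: "inj_on i (pts X)" "inj_on j (pts Y)"
        and "i ` pts X \<inter> j ` pts Y = {}"
        using d by (auto simp: decomposition_def)
      then have ne: "i x \<noteq> j y" "j y \<noteq> i x" if "x \<in> pts X" "y \<in> pts Y" for x y
        using that by (metis disjoint_iff imageI)+
      fix p q assume "p \<in> pts ?C" "q \<in> pts ?C" "?\<phi> p = ?\<phi> q"
      then show "p = q"
        by (auto simp: ne inj_on_eq_iff[OF inj(1)] inj_on_eq_iff[OF inj(2)])
    qed
    ultimately show ?thesis
      using d by (simp add: bij_betw_def decomposition_def)
  qed
  have "compose (pts X) ?\<phi> (inj1 X) = i"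
    by (rule extensionalityI[OF compose_extensional gmaps_extensional[OF i]])
      (simp add: compose_eq inj1_def)
  moreover have "compose (pts Y) ?\<phi> (inj2 Y) = j"
    by (rule extensionalityI[OF compose_extensional gmaps_extensional[OF j]])
      (simp add: compose_eq inj2_def)
  ultimately have r: "res X ?C (inj1 X) (res ?C A ?\<phi> u) = res X A i u"
    "res Y ?C (inj2 Y) (res ?C A ?\<phi> u) = res Y A j u" if "u \<in> carrier (T A)" for u
    using res_compose[OF X C A inj1_gmaps[OF X] \<phi> that] res_compose[OF Y C A inj2_gmaps[OF Y] \<phi> that]
    by simp_all
  have "inj_on (\<lambda>t. (res X ?C (inj1 X) t, res Y ?C (inj2 Y) t)) (carrier (T ?C))"
    using coprod[OF X Y] by (auto simp: ring_iso_def bij_betw_def)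
  then have "res ?C A ?\<phi> s = res ?C A ?\<phi> t"
    using r[OF s] r[OF t] assms(4,5) res_closed[OF C A \<phi> s] res_closed[OF C A \<phi> t]
    by (auto simp: inj_on_def)
  then show ?thesis
    using res_iso_inj[OF C A \<phi> bij s t] by simp
qed

text \<open>Transfer along an embedding is extension by zero, so \<open>t\<close> is the sum of the
  extensions of its two restrictions.\<close>

lemma decomposition_tr:
  assumes d: "decomposition X i Y j A" and B: "fin_gset G B" and f: "f \<in> gmaps G A B"
    and t: "t \<in> carrier (T A)"
  shows "tr A B f t = tr X B (compose (pts X) f i) (res X A i t) \<oplus>\<^bsub>T B\<^esub>
    tr Y B (compose (pts Y) f j) (res Y A j t)"
proof -
  have X: "fin_gset G X" and Y: "fin_gset G Y" and A: "fin_gset G A" and i: "i \<in> gmaps G X A"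
    and j: "j \<in> gmaps G Y A" and inj: "inj_on i (pts X)" "inj_on j (pts Y)"
    and disj: "i ` pts X \<inter> j ` pts Y = {}" "j ` pts Y \<inter> i ` pts X = {}"
    using d by (auto simp: decomposition_def)
  interpret RX: cring "T X" using cring X .
  interpret RY: cring "T Y" using cring Y .
  interpret RA: cring "T A" using cring A .
  let ?x = "res X A i t" and ?y = "res Y A j t"
  have x: "?x \<in> carrier (T X)" and y: "?y \<in> carrier (T Y)"
    using res_closed X Y A i j t by auto
  have c: "tr X A i ?x \<in> carrier (T A)" "tr Y A j ?y \<in> carrier (T A)"
    using tr_closed X Y A i j x y by auto
  have "t = tr X A i ?x \<oplus>\<^bsub>T A\<^esub> tr Y A j ?y"
    by (rule decomposition_eqI[OF d t])
      (use c x y in \<open>simp_all add: res_add[OF X A i] res_add[OF Y A j] res_tr_inj[OF X A i inj(1)]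
        res_tr_inj[OF Y A j inj(2)] res_tr_disjoint[OF X Y A i j disj(1)]
        res_tr_disjoint[OF Y X A j i disj(2)]\<close>)
  then have "tr A B f t = tr A B f (tr X A i ?x) \<oplus>\<^bsub>T B\<^esub> tr A B f (tr Y A j ?y)"
    using tr_add[OF A B f c] by simp
  then show ?thesis
    using tr_compose[OF X A B i f x] tr_compose[OF Y A B j f y] by simp
qed

text \<open>Norm along an embedding is extension by one, so \<open>t\<close> is the product of the
  extensions of its two restrictions.\<close>

lemma decomposition_nm:
  assumes d: "decomposition X i Y j A" and B: "fin_gset G B" and f: "f \<in> gmaps G A B"
    and t: "t \<in> carrier (T A)"
  shows "nm A B f t = nm X B (compose (pts X) f i) (res X A i t) \<otimes>\<^bsub>T B\<^esub>
    nm Y B (compose (pts Y) f j) (res Y A j t)"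
proof -
  have X: "fin_gset G X" and Y: "fin_gset G Y" and A: "fin_gset G A" and i: "i \<in> gmaps G X A"
    and j: "j \<in> gmaps G Y A" and inj: "inj_on i (pts X)" "inj_on j (pts Y)"
    and disj: "i ` pts X \<inter> j ` pts Y = {}" "j ` pts Y \<inter> i ` pts X = {}"
    using d by (auto simp: decomposition_def)
  interpret RX: cring "T X" using cring X .
  interpret RY: cring "T Y" using cring Y .
  interpret RA: cring "T A" using cring A .
  let ?x = "res X A i t" and ?y = "res Y A j t"
  have x: "?x \<in> carrier (T X)" and y: "?y \<in> carrier (T Y)"
    using res_closed X Y A i j t by auto
  have c: "nm X A i ?x \<in> carrier (T A)" "nm Y A j ?y \<in> carrier (T A)"
    using nm_closed X Y A i j x y by auto
  have "t = nm X A i ?x \<otimes>\<^bsub>T A\<^esub> nm Y A j ?y"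
    by (rule decomposition_eqI[OF d t])
      (use c x y in \<open>simp_all add: res_mult[OF X A i] res_mult[OF Y A j] res_nm_inj[OF X A i inj(1)]
        res_nm_inj[OF Y A j inj(2)] res_nm_disjoint[OF X Y A i j disj(1)]
        res_nm_disjoint[OF Y X A j i disj(2)]\<close>)
  then have "nm A B f t = nm A B f (nm X A i ?x) \<otimes>\<^bsub>T B\<^esub> nm A B f (nm Y A j ?y)"
    using nm_mult[OF A B f c] by simp
  then show ?thesis
    using nm_compose[OF X A B i f x] nm_compose[OF Y A B j f y] by simp
qed

end

section \<open>Dependent products\<close>

lemma fset_graph_of_encode_section:
  "finite D \<Longrightarrow> fset (graph_of (encode_section D s)) = (\<lambda>x. (x, s x)) ` D"
  by (simp add: encode_section_def Abs_fset_inverse)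

lemma apply_encode_section [simp]:
  "finite D \<Longrightarrow> x \<in> D \<Longrightarrow> apply_section (encode_section D s) x = s x"
  unfolding apply_section_def by (rule the_equality) (auto simp: fset_graph_of_encode_section)

lemma encode_section_cong: "(\<And>x. x \<in> D \<Longrightarrow> s x = s' x) \<Longrightarrow> encode_section D s = encode_section D s'"
  by (auto simp: encode_section_def intro!: arg_cong[where f = Abs_fset] image_cong)

lemma encode_section_eqD:
  "\<lbrakk>encode_section D s = encode_section D s'; finite D; x \<in> D\<rbrakk> \<Longrightarrow> s x = s' x"
  by (metis apply_encode_section)

lemma (in group) act_fibre:
  assumes "fin_gset G X" "f \<in> gmaps G X Y" "g \<in> carrier G" "x \<in> fibre X f y"
  shows "act X g x \<in> fibre X f (act Y g y)"
  using assms by (auto simp: fibre_def act_closed gmaps_act)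

lemma (in group) act_inv_fibre:
  assumes "fin_gset G X" "fin_gset G Y" "f \<in> gmaps G X Y" "g \<in> carrier G" "y \<in> pts Y"
    and "x \<in> fibre X f (act Y g y)"
  shows "act X (inv g) x \<in> fibre X f y"
  using act_fibre[OF assms(1,3), of "inv g" x "act Y g y"] assms(4-6) act_inv(1)[OF assms(2)] by simp

locale dep_prod = group G for G :: "('g, 'm) monoid_scheme" (structure) +
  fixes A X Y :: "'g pset" and q f :: "'g point \<Rightarrow> 'g point"
  assumes A: "fin_gset G A" and X: "fin_gset G X" and Y: "fin_gset G Y"
    and q: "q \<in> gmaps G A X" and f: "f \<in> gmaps G X Y"
begin

abbreviation F where "F \<equiv> fibre X f"
text \<open>\<open>dep_prod_gset\<close> lets \<open>s\<close> be arbitrary off the fibre, where the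
  encoded graph does not see it. Extensional functions give one representative for each point, so
  that points can be compared and counted through \<open>s\<close>.\<close>

abbreviation sections where "sections y \<equiv> PiE (F y) (fibre A q)"
abbreviation D where "D \<equiv> dep_prod_gset G A q X f Y"
abbreviation p where "p \<equiv> dep_prod_proj G A q X f Y"
abbreviation E where "E \<equiv> pullback_gset X f D p"
abbreviation r where "r \<equiv> pullback_snd X f D p"
abbreviation e where "e \<equiv> dep_prod_eval G A q X f Y"

definition pt where "pt y s = Tup y (encode_section (F y) s)"

lemma finite_fibre: "finite (F y)" "finite (fibre A q x)"
  using fin_gset_finite[OF X] fin_gset_finite[OF A] by (auto simp: fibre_def)

lemma pt_eq_iff:
  assumes "s \<in> sections y" "s' \<in> sections y'"
  shows "pt y s = pt y' s' \<longleftrightarrow> y = y' \<and> s = s'"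
proof
  assume "pt y s = pt y' s'"
  then have y: "y = y'" and "encode_section (F y) s = encode_section (F y) s'"
    by (auto simp: pt_def)
  then have "s x = s' x" if "x \<in> F y" for x
    using encode_section_eqD[OF _ finite_fibre(1)] that by blast
  then have "s = s'"
    using assms y by (intro PiE_ext[of s "F y" "fibre A q" s']) auto
  with y show "y = y' \<and> s = s'" ..
qed simp

lemma pts_D: "pts D = {pt y s |y s. y \<in> pts Y \<and> s \<in> sections y}"
proof (intro equalityI subsetI)
  fix z assume "z \<in> pts D"
  then obtain y s where z: "z = pt y s" "y \<in> pts Y" "s \<in> F y \<rightarrow> pts A" "\<forall>x\<in>F y. q (s x) = x"
    by (auto simp: dep_prod_gset_def Let_def pt_def)
  then have "z = pt y (restrict s (F y))" "restrict s (F y) \<in> sections y"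
    by (auto simp: pt_def fibre_def intro!: encode_section_cong)
  with z(2) show "z \<in> {pt y s |y s. y \<in> pts Y \<and> s \<in> sections y}"
    by blast
next
  fix z assume "z \<in> {pt y s |y s. y \<in> pts Y \<and> s \<in> sections y}"
  then obtain y s where z: "z = pt y s" "y \<in> pts Y" "s \<in> sections y"
    by blast
  then have "s \<in> F y \<rightarrow> pts A" "\<forall>x\<in>F y. q (s x) = x"
    by (auto simp: fibre_def PiE_def Pi_def)
  with z(1,2) show "z \<in> pts D"
    by (auto simp: dep_prod_gset_def Let_def pt_def)
qed

lemma pt_in_D: "y \<in> pts Y \<Longrightarrow> s \<in> sections y \<Longrightarrow> pt y s \<in> pts D"
  by (auto simp: pts_D)

lemma D_cases:
  assumes "d \<in> pts D"
  obtains y s where "d = pt y s" "y \<in> pts Y" "s \<in> sections y"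
  using assms by (auto simp: pts_D)

definition conj_section where
  "conj_section g y s = (\<lambda>x\<in>F (act Y g y). act A g (s (act X (inv g) x)))"

lemma conj_section:
  assumes g: "g \<in> carrier G" and y: "y \<in> pts Y" and s: "s \<in> sections y"
  shows "conj_section g y s \<in> sections (act Y g y)"
proof (rule PiE_I)
  fix x assume x: "x \<in> F (act Y g y)"
  then have "act X (inv g) x \<in> F y"
    using act_inv_fibre[OF X Y f g y] by simp
  then have "act A g (s (act X (inv g) x)) \<in> fibre A q (act X g (act X (inv g) x))"
    using s act_fibre[OF A q g] by (auto simp: PiE_def Pi_def)
  then show "conj_section g y s x \<in> fibre A q x"
    using x act_inv(2)[OF X g] by (auto simp: conj_section_def fibre_def)
qed (simp add: conj_section_def)

lemma act_D:
  assumes g: "g \<in> carrier G" and y: "y \<in> pts Y" and s: "s \<in> sections y"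
  shows "act D g (pt y s) = pt (act Y g y) (conj_section g y s)"
proof -
  have "pts D = {Tup y (encode_section (fibre X f y) s) |y s.
      y \<in> pts Y \<and> s \<in> fibre X f y \<rightarrow> pts A \<and> (\<forall>x\<in>fibre X f y. q (s x) = x)}"
    by (simp add: dep_prod_gset_def Let_def)
  then have "act D g (pt y s) = Tup (act Y g (fst_pt (pt y s)))
      (encode_section (F (act Y g (fst_pt (pt y s))))
        (\<lambda>x. act A g (apply_section (snd_pt (pt y s)) (act X (inv g) x))))"
    using pt_in_D[OF y s] by (simp add: dep_prod_gset_def Let_def)
  also have "\<dots> = pt (act Y g y) (conj_section g y s)"
    using finite_fibre act_inv_fibre[OF X Y f g y]
    by (auto simp: pt_def conj_section_def intro!: encode_section_cong)
  finally show ?thesis .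
qed

lemma fin_gset_D: "fin_gset G D"
proof (rule fin_gsetI)
  have "pts D = (\<lambda>(y, s). pt y s) ` (SIGMA y:pts Y. sections y)"
    by (auto simp: pts_D)
  then show "finite (pts D)"
    using fin_gset_finite[OF Y] finite_fibre by (simp add: finite_PiE)
  fix g assume g: "g \<in> carrier G"
  show "act D g d \<in> pts D" if "d \<in> pts D" for d
    using that g by (elim D_cases) (simp add: act_D pt_in_D act_closed[OF Y] conj_section)
  show "act D g \<in> extensional (pts D)"
    by (simp add: dep_prod_gset_def Let_def)
  show "act D (g \<otimes> h) d = act D g (act D h d)" if h: "h \<in> carrier G" and d: "d \<in> pts D" for h d
  proof -
    obtain y s where d: "d = pt y s" and y: "y \<in> pts Y" and s: "s \<in> sections y"
      using d by (elim D_cases)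
    have hs: "conj_section h y s \<in> sections (act Y h y)" and hy: "act Y h y \<in> pts Y"
      using conj_section[OF h y s] act_closed[OF Y h y] by auto
    have "conj_section (g \<otimes> h) y s = conj_section g (act Y h y) (conj_section h y s)"
      unfolding conj_section_def act_mult[OF Y g h y]
    proof (rule restrict_ext)
      fix x assume x: "x \<in> F (act Y g (act Y h y))"
      then have xX: "x \<in> pts X"
        by (simp add: fibre_def)
      have gx: "act X (inv g) x \<in> F (act Y h y)"
        using act_inv_fibre[OF X Y f g hy x] .
      have hgx: "act X (inv h) (act X (inv g) x) \<in> F y"
        using act_inv_fibre[OF X Y f h y gx] .
      then have "s (act X (inv h) (act X (inv g) x)) \<in> pts A"
        using s by (auto simp: PiE_def Pi_def fibre_def)
      moreover have "act X (inv (g \<otimes> h)) x = act X (inv h) (act X (inv g) x)"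
        using g h xX by (simp add: inv_mult_group act_mult[OF X])
      ultimately show "act A (g \<otimes> h) (s (act X (inv (g \<otimes> h)) x)) =
          act A g ((\<lambda>x\<in>F (act Y h y). act A h (s (act X (inv h) x))) (act X (inv g) x))"
        using gx g h by (simp add: act_mult[OF A])
    qed
    then show ?thesis
      using g h y s d hs hy by (simp add: act_D act_mult[OF Y])
  qed
next
  fix d assume "d \<in> pts D"
  then obtain y s where d: "d = pt y s" and y: "y \<in> pts Y" and s: "s \<in> sections y"
    by (elim D_cases)
  have "conj_section \<one> y s = s"
  proof (rule extensionalityI[where A = "F y"])
    fix x assume x: "x \<in> F y"
    then have "x \<in> pts X" "s x \<in> pts A"
      using s by (auto simp: PiE_def Pi_def fibre_def)
    then show "conj_section \<one> y s x = s x"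
      using x y by (simp add: conj_section_def act_one[OF Y] act_one[OF X] act_one[OF A])
  qed (use s y in \<open>auto simp: conj_section_def act_one[OF Y] PiE_def\<close>)
  then show "act D \<one> d = d"
    using d y s by (simp add: act_D act_one[OF Y])
qed

lemma p_pt [simp]: "y \<in> pts Y \<Longrightarrow> s \<in> sections y \<Longrightarrow> p (pt y s) = y"
  using pt_in_D[of y s] by (simp add: dep_prod_proj_def) (simp add: pt_def)

lemma p_gmaps: "p \<in> gmaps G D Y"
proof (rule gmapsI)
  show "p \<in> extensional (pts D)"
    by (simp add: dep_prod_proj_def)
  show "p d \<in> pts Y" if "d \<in> pts D" for d
    using that by (auto elim!: D_cases)
  show "p (act D g d) = act Y g (p d)" if "g \<in> carrier G" "d \<in> pts D" for g d
    using that by (elim D_cases) (simp add: act_D act_closed[OF Y] conj_section)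
qed

lemmas fin_gset_E = fin_gset_pullback[OF X fin_gset_D f p_gmaps]
lemmas r_gmaps = pullback_snd_gmaps[OF X fin_gset_D f p_gmaps]

lemma E_cases:
  assumes "z \<in> pts E"
  obtains x s where "z = Tup x (pt (f x) s)" "x \<in> pts X" "s \<in> sections (f x)"
  using assms by (force elim!: pullback_cases D_cases)

lemma e_Tup [simp]:
  assumes "x \<in> pts X" "s \<in> sections (f x)"
  shows "e (Tup x (pt (f x) s)) = s x"
proof -
  have "f x \<in> pts Y" "x \<in> F (f x)"
    using assms gmaps_closed[OF f] by (auto simp: fibre_def)
  then have "Tup x (pt (f x) s) \<in> pts E"
    using assms by (simp add: pt_in_D)
  then show ?thesis
    using \<open>x \<in> F (f x)\<close> finite_fibre by (simp add: dep_prod_eval_def) (simp add: pt_def)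
qed

lemma e_gmaps: "e \<in> gmaps G E A"
proof (rule gmapsI)
  show "e \<in> extensional (pts E)"
    by (simp add: dep_prod_eval_def)
  fix z assume "z \<in> pts E"
  then obtain x s where z: "z = Tup x (pt (f x) s)" and x: "x \<in> pts X" and s: "s \<in> sections (f x)"
    by (elim E_cases)
  have fx: "f x \<in> pts Y" and xF: "x \<in> F (f x)"
    using x gmaps_closed[OF f] by (auto simp: fibre_def)
  then have "s x \<in> pts A"
    using s by (auto simp: PiE_def Pi_def fibre_def)
  then show "e z \<in> pts A"
    using z x s by simp
  fix g assume g: "g \<in> carrier G"
  have gx: "act X g x \<in> pts X" "f (act X g x) = act Y g (f x)" "act X g x \<in> F (act Y g (f x))"
    using act_closed[OF X g x] gmaps_act[OF f g x] act_fibre[OF X f g xF] by auto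
  have "act E g z = Tup (act X g x) (pt (f (act X g x)) (conj_section g (f x) s))"
    using z x g s fx gx(2) by (simp add: act_D pt_in_D)
  moreover have "conj_section g (f x) s \<in> sections (f (act X g x))"
    using conj_section[OF g fx s] gx(2) by simp
  ultimately have "e (act E g z) = conj_section g (f x) s (act X g x)"
    using gx(1) by simp
  also have "\<dots> = act A g (s x)"
    using gx(3) act_inv(1)[OF X g x] by (simp add: conj_section_def)
  finally show "e (act E g z) = act A g (e z)"
    using z x s by simp
qed

lemma fibre_p: "y \<in> pts Y \<Longrightarrow> fibre D p y = pt y ` sections y"
  using pt_in_D[of y] by (force simp: fibre_def elim!: D_cases)

text \<open>A section chooses a point in each fibre of \<open>q\<close> independently.\<close>

lemma card_fibre_p:
  assumes "y \<in> pts Y"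
  shows "card (fibre D p y) = (\<Prod>x\<in>F y. card (fibre A q x))"
proof -
  have "inj_on (pt y) (sections y)"
    using pt_eq_iff by (auto simp: inj_on_def)
  then show ?thesis
    using fibre_p[OF assms] finite_fibre by (simp add: card_image card_PiE)
qed

end

section \<open>Frobenius reciprocity\<close>

context tambara_functor
begin

lemma nm_tr_dep_prod:
  assumes "dep_prod G A X Y q f" and t: "t \<in> carrier (T A)"
  defines "D \<equiv> dep_prod_gset G A q X f Y" and "p \<equiv> dep_prod_proj G A q X f Y"
    and "e \<equiv> dep_prod_eval G A q X f Y"
  shows "nm X Y f (tr A X q t) = tr D Y p (nm (pullback_gset X f D p) D (pullback_snd X f D p)
    (res (pullback_gset X f D p) A e t))"
proof -
  interpret dep_prod G A X Y q f by fact
  show ?thesis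
    unfolding D_def p_def e_def by (rule nm_tr[OF A X Y q f t refl refl refl refl refl])
qed

text \<open>The norm along the fold map \<open>Y \<amalg> Y \<rightarrow> Y\<close> is multiplication, so \<open>t \<cdot> f\<^sub>+ s\<close> is the norm of the
  transfer of \<open>(t, s)\<close> along \<open>id \<amalg> f\<close>. The dependent product of this pair of maps is \<open>X\<close>.\<close>

lemma frobenius:
  assumes X: "fin_gset G X" and Y: "fin_gset G Y" and f: "f \<in> gmaps G X Y"
    and t: "t \<in> carrier (T Y)" and s: "s \<in> carrier (T X)"
  shows "t \<otimes>\<^bsub>T Y\<^esub> tr X Y f s = tr X Y f (res X Y f t \<otimes>\<^bsub>T X\<^esub> s)"
proof -
  let ?id = "\<lambda>y\<in>pts Y. y"
  define A where "A = coprod_gset Y X"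
  define B where "B = coprod_gset Y Y"
  define h where "h = copair Y Y ?id ?id"
  \<comment> \<open>\<open>q\<close> is the identity on the first summand and \<open>f\<close> on
    the second; \<open>h\<close> is the fold map.\<close>
  define q where "q = copair Y X (inj1 Y) (compose (pts X) (inj2 Y) f)"
  have A: "fin_gset G A" and B: "fin_gset G B"
    using X Y by (auto simp: A_def B_def fin_gset_coprod)
  have i1: "inj1 Y \<in> gmaps G Y A" "inj1 Y \<in> gmaps G Y B" and i2: "inj2 X \<in> gmaps G X A"
    "inj2 Y \<in> gmaps G Y B"
    using X Y by (auto simp: A_def B_def inj1_gmaps inj2_gmaps)
  have h: "h \<in> gmaps G B Y" and q: "q \<in> gmaps G A B"
    using X Y f i1 i2 unfolding h_def q_def A_def B_def
    by (auto intro!: copair_gmaps id_gmaps compose_gmaps)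
  have dA: "decomposition Y (inj1 Y) X (inj2 X) A" and dB: "decomposition Y (inj1 Y) Y (inj2 Y) B"
    using X Y by (auto simp: A_def B_def decomposition_coprod)
  interpret P: dep_prod G A B Y q h
    by unfold_locales (use A B Y q h in auto)
  interpret RA: cring "T A" using cring A .
  interpret RX: cring "T X" using cring X .
  interpret RY: cring "T Y" using cring Y .
  \<comment> \<open>\<open>w\<close> stands for the pair \<open>(t, s)\<close>: it is the element of
    \<open>T A\<close> with these two restrictions.\<close>
  define w where "w = tr Y A (inj1 Y) t \<oplus>\<^bsub>T A\<^esub> tr X A (inj2 X) s"
  have inj: "inj_on (inj1 Y) (pts Y)" "inj_on (inj2 X) (pts X)"
    "inj1 Y ` pts Y \<inter> inj2 X ` pts X = {}" "inj2 X ` pts X \<inter> inj1 Y ` pts Y = {}"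
    using dA by (auto simp: decomposition_def)
  have c: "tr Y A (inj1 Y) t \<in> carrier (T A)" "tr X A (inj2 X) s \<in> carrier (T A)"
    using tr_closed X Y A i1 i2 t s by auto
  then have w: "w \<in> carrier (T A)"
    by (simp add: w_def)
  have w1: "res Y A (inj1 Y) w = t"
    using c t by (simp add: w_def res_add[OF Y A i1(1)] res_tr_inj[OF Y A i1(1) inj(1)]
        res_tr_disjoint[OF X Y A i2(1) i1(1) inj(4)] s)
  have w2: "res X A (inj2 X) w = s"
    using c s by (simp add: w_def res_add[OF X A i2(1)] res_tr_inj[OF X A i2(1) inj(2)]
        res_tr_disjoint[OF Y X A i1(1) i2(1) inj(3)] t)
  have inj': "inj_on (inj1 Y) (pts Y)" "inj_on (inj2 Y) (pts Y)"
    "inj1 Y ` pts Y \<inter> inj2 Y ` pts Y = {}" "inj2 Y ` pts Y \<inter> inj1 Y ` pts Y = {}"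
    using dB by (auto simp: decomposition_def)

  have lhs: "nm B Y h (tr A B q w) = t \<otimes>\<^bsub>T Y\<^esub> tr X Y f s"
  proof -
    have fs: "tr X Y f s \<in> carrier (T Y)"
      using tr_closed X Y f s by auto
    have "compose (pts Y) q (inj1 Y) = inj1 Y"
      by (auto simp: compose_def q_def inj1_def)
    moreover have "compose (pts X) q (inj2 X) = compose (pts X) (inj2 Y) f"
      by (auto simp: compose_def q_def inj2_def)
    ultimately have qw: "tr A B q w = tr Y B (inj1 Y) t \<oplus>\<^bsub>T B\<^esub> tr Y B (inj2 Y) (tr X Y f s)"
      using decomposition_tr[OF dA B q w] tr_compose[OF X Y B f i2(2) s] by (simp add: w1 w2)
    have c': "tr Y B (inj1 Y) t \<in> carrier (T B)" "tr Y B (inj2 Y) (tr X Y f s) \<in> carrier (T B)"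
      using tr_closed Y B i1 i2 t fs by auto
    have "res Y B (inj1 Y) (tr A B q w) = t"
      using c' t fs unfolding qw
      by (simp add: res_add[OF Y B i1(2)] res_tr_inj[OF Y B i1(2) inj'(1)]
          res_tr_disjoint[OF Y Y B i2(2) i1(2) inj'(4)])
    moreover have "res Y B (inj2 Y) (tr A B q w) = tr X Y f s"
      using c' t fs unfolding qw
      by (simp add: res_add[OF Y B i2(2)] res_tr_inj[OF Y B i2(2) inj'(2)]
          res_tr_disjoint[OF Y Y B i1(2) i2(2) inj'(3)])
    moreover have "compose (pts Y) h (inj1 Y) = ?id" "compose (pts Y) h (inj2 Y) = ?id"
      by (auto simp: compose_def h_def inj1_def inj2_def)
    ultimately show ?thesis
      using decomposition_nm[OF dB Y h tr_closed[OF A B q w]] nm_id[OF Y] t fs by simp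
  qed

  have Bs: "In1 y \<in> pts B" "In2 y \<in> pts B" "h (In1 y) = y" "h (In2 y) = y"
    "act B g (In1 y) = In1 (act Y g y)" "act B g (In2 y) = In2 (act Y g y)"
    if "y \<in> pts Y" for y g
    using that by (auto simp: B_def h_def)
  have B_cases: "b = In1 (h b) \<or> b = In2 (h b)" if "b \<in> pts B" for b
    using that by (auto simp: B_def h_def)
  have As: "act A g (In2 x) = In2 (act X g x)" if "x \<in> pts X" for x g
    using that by (auto simp: A_def)
  have fib: "P.F y = {In1 y, In2 y}" if "y \<in> pts Y" for y
    using that by (auto simp: fibre_def B_def h_def)
  have fq1: "fibre A q (In1 y) = {In1 y}" if "y \<in> pts Y" for y
    using that gmaps_closed[OF f] by (auto simp: fibre_def A_def q_def inj1_def inj2_def compose_def)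
  have fq2: "fibre A q (In2 y) = In2 ` fibre X f y" if "y \<in> pts Y" for y
    using that gmaps_closed[OF f] by (auto simp: fibre_def A_def q_def inj1_def inj2_def compose_def)
  \<comment> \<open>\<open>E\<close> is the base change of the fold map \<open>h\<close> along
    \<open>p\<close>, hence two copies of \<open>D\<close>.\<close>
  define j1 where "j1 = (\<lambda>d\<in>pts P.D. Tup (In1 (P.p d)) d)"
  define j2 where "j2 = (\<lambda>d\<in>pts P.D. Tup (In2 (P.p d)) d)"
  note D = P.fin_gset_D and E = P.fin_gset_E and p = P.p_gmaps and r = P.r_gmaps and e = P.e_gmaps
  have jE: "Tup (In1 (P.p d)) d \<in> pts P.E" "Tup (In2 (P.p d)) d \<in> pts P.E" if "d \<in> pts P.D" for d
    using that gmaps_closed[OF p that] by (simp_all add: Bs)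
  have j1: "j1 \<in> gmaps G P.D P.E" unfolding j1_def
    by (rule restrict_gmaps[OF D])
      (use jE in \<open>simp_all add: gmaps_act[OF p] gmaps_closed[OF p] Bs\<close>)
  have j2: "j2 \<in> gmaps G P.D P.E" unfolding j2_def
    by (rule restrict_gmaps[OF D])
      (use jE in \<open>simp_all add: gmaps_act[OF p] gmaps_closed[OF p] Bs\<close>)
  have dE: "decomposition P.D j1 P.D j2 P.E"
  proof -
    have "pts P.E \<subseteq> j1 ` pts P.D \<union> j2 ` pts P.D"
    proof
      fix z assume "z \<in> pts P.E"
      then obtain b d where z: "z = Tup b d" "b \<in> pts B" "d \<in> pts P.D" "h b = P.p d"
        by (elim pullback_cases)
      then have "b = In1 (P.p d) \<or> b = In2 (P.p d)"
        using B_cases by metis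
      with z show "z \<in> j1 ` pts P.D \<union> j2 ` pts P.D"
        by (auto simp: j1_def j2_def)
    qed
    moreover have "j1 ` pts P.D \<union> j2 ` pts P.D \<subseteq> pts P.E"
      using gmaps_closed[OF j1] gmaps_closed[OF j2] by blast
    moreover have "inj_on j1 (pts P.D)" "inj_on j2 (pts P.D)" "j1 ` pts P.D \<inter> j2 ` pts P.D = {}"
      by (auto simp: j1_def j2_def inj_on_def)
    ultimately show ?thesis
      unfolding decomposition_def using D E j1 j2 by (intro conjI equalityI[of "_ \<union> _"])
  qed
  have rj: "compose (pts P.D) P.r j1 = (\<lambda>d\<in>pts P.D. d)" "compose (pts P.D) P.r j2 = (\<lambda>d\<in>pts P.D. d)"
    using jE by (auto simp: compose_def j1_def j2_def pullback_snd_def)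

  \<comment> \<open>A section over \<open>y\<close> is forced at \<open>In1 y\<close> and free at
    \<open>In2 y\<close>, where it picks a point of the fibre of \<open>f\<close>. So
    \<open>\<tau>\<close> below identifies \<open>X\<close> with the dependent product.\<close>
  have sec: "P.sections y = (\<lambda>x. \<lambda>z\<in>P.F y. if z = In1 y then In1 y else In2 x) ` fibre X f y"
    (is "_ = ?S") if y: "y \<in> pts Y" for y
  proof (intro equalityI subsetI)
    fix \<sigma> assume \<sigma>: "\<sigma> \<in> P.sections y"
    then obtain x where "\<sigma> (In1 y) = In1 y" "\<sigma> (In2 y) = In2 x" "x \<in> fibre X f y"
      using fq1[OF y] fq2[OF y] fib[OF y] by (auto simp: PiE_def Pi_def)
    then have "\<sigma> = (\<lambda>z\<in>P.F y. if z = In1 y then In1 y else In2 x)"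
      using \<sigma> fib[OF y] by (intro extensionalityI[where A = "P.F y"]) (auto simp: PiE_def)
    then show "\<sigma> \<in> ?S"
      using \<open>x \<in> fibre X f y\<close> by blast
  next
    fix \<sigma> assume "\<sigma> \<in> ?S"
    then show "\<sigma> \<in> P.sections y"
      using fq1[OF y] fq2[OF y] fib[OF y] by (auto simp: PiE_iff)
  qed
  define \<tau> where "\<tau> x = P.pt (f x) (\<lambda>z\<in>P.F (f x). if z = In1 (f x) then In1 (f x) else In2 x)" for x
  have \<tau>: "\<tau> x \<in> pts P.D" "P.p (\<tau> x) = f x" "P.e (j1 (\<tau> x)) = In1 (f x)" "P.e (j2 (\<tau> x)) = In2 x"
    if x: "x \<in> pts X" for x
  proof -
    let ?\<sigma> = "\<lambda>z\<in>P.F (f x). if z = In1 (f x) then In1 (f x) else In2 x"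
    have fx: "f x \<in> pts Y"
      using gmaps_closed[OF f x] .
    then have \<sigma>: "?\<sigma> \<in> P.sections (f x)"
      using x sec by (auto simp: fibre_def)
    with fx show 1: "\<tau> x \<in> pts P.D" and 2: "P.p (\<tau> x) = f x"
      by (simp_all add: \<tau>_def P.pt_in_D)
    have B: "In1 (f x) \<in> pts B" "In2 (f x) \<in> pts B" and "h (In1 (f x)) = f x" "h (In2 (f x)) = f x"
      using fx by (auto simp: Bs)
    then have "P.e (Tup (In1 (f x)) (\<tau> x)) = ?\<sigma> (In1 (f x))"
      "P.e (Tup (In2 (f x)) (\<tau> x)) = ?\<sigma> (In2 (f x))"
      using P.e_Tup[of "In1 (f x)" ?\<sigma>] P.e_Tup[of "In2 (f x)" ?\<sigma>] \<sigma> by (simp_all only: \<tau>_def)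
    then show "P.e (j1 (\<tau> x)) = In1 (f x)" "P.e (j2 (\<tau> x)) = In2 x"
      using 1 2 fib[OF fx] by (simp_all add: j1_def j2_def)
  qed
  have \<tau>_surj: "\<exists>x\<in>pts X. d = \<tau> x" if d: "d \<in> pts P.D" for d
    using d
  proof (rule P.D_cases)
    fix y \<sigma> assume "d = P.pt y \<sigma>" "y \<in> pts Y" "\<sigma> \<in> P.sections y"
    then show ?thesis
      using sec[of y] by (auto simp: \<tau>_def fibre_def)
  qed
  \<comment> \<open>The inverse of \<open>\<tau>\<close>, written through \<open>e\<close> and
    \<open>j2\<close> so that its equivariance follows from theirs.\<close>
  define \<psi> where "\<psi> = (\<lambda>d\<in>pts P.D. case P.e (j2 d) of In2 x \<Rightarrow> x)"
  have \<psi>\<tau>: "\<psi> (\<tau> x) = x" if "x \<in> pts X" for x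
    using \<tau>[OF that] by (simp add: \<psi>_def)
  have \<psi>: "\<psi> \<in> gmaps G P.D X"
  proof (rule gmapsI)
    show "\<psi> d \<in> pts X" if "d \<in> pts P.D" for d
      using \<tau>_surj[OF that] \<psi>\<tau> by auto
    fix g d assume g: "g \<in> carrier G" and d: "d \<in> pts P.D"
    then obtain x where x: "x \<in> pts X" "d = \<tau> x"
      using \<tau>_surj by blast
    have "P.e (j2 (act P.D g d)) = act A g (P.e (j2 d))"
      using gmaps_act[OF j2 g d] gmaps_act[OF e g gmaps_closed[OF j2 d]] by simp
    also have "\<dots> = In2 (act X g x)"
      using x \<tau>(4) by (simp add: As)
    finally show "\<psi> (act P.D g d) = act X g (\<psi> d)"
      using act_closed[OF D g d] x \<psi>\<tau> by (simp add: \<psi>_def)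
  qed (simp add: \<psi>_def)
  have "\<tau> (\<psi> d) = d" if "d \<in> pts P.D" for d
    using \<tau>_surj[OF that] \<psi>\<tau> by auto
  then have bij: "bij_betw \<psi> (pts P.D) (pts X)"
    by (intro bij_betw_byWitness[where f' = \<tau>])
      (use \<psi>\<tau> \<tau>(1) gmaps_closed[OF \<psi>] in auto)
  have p_eq: "P.p = compose (pts P.D) f \<psi>"
  proof (rule extensionalityI[OF gmaps_extensional[OF p] compose_extensional])
    fix d assume d: "d \<in> pts P.D"
    with \<tau>_surj obtain x where "x \<in> pts X" "d = \<tau> x"
      by blast
    with d show "P.p d = compose (pts P.D) f \<psi> d"
      by (simp add: compose_eq \<tau> \<psi>\<tau>)
  qed
  \<comment> \<open>On the first copy evaluation sees only the base point, which yields
    \<open>t\<close> restricted along \<open>p\<close>, that is, along \<open>f\<close> and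
    \<open>\<psi>\<close>. On the second copy it is \<open>\<psi>\<close>, which yields
    \<open>s\<close>.\<close>
  have ej1: "compose (pts P.D) P.e j1 = compose (pts P.D) (inj1 Y) P.p"
  proof (rule extensionalityI[OF compose_extensional compose_extensional])
    fix d assume d: "d \<in> pts P.D"
    with \<tau>_surj obtain x where "x \<in> pts X" "d = \<tau> x"
      by blast
    with d show "compose (pts P.D) P.e j1 d = compose (pts P.D) (inj1 Y) P.p d"
      using gmaps_closed[OF f] by (simp add: compose_eq \<tau> inj1_def)
  qed
  have ej2: "compose (pts P.D) P.e j2 = compose (pts P.D) (inj2 X) \<psi>"
  proof (rule extensionalityI[OF compose_extensional compose_extensional])
    fix d assume d: "d \<in> pts P.D"
    with \<tau>_surj obtain x where "x \<in> pts X" "d = \<tau> x"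
      by blast
    with d show "compose (pts P.D) P.e j2 d = compose (pts P.D) (inj2 X) \<psi> d"
      by (simp add: compose_eq \<tau> \<psi>\<tau> inj2_def)
  qed

  have ft: "res X Y f t \<in> carrier (T X)"
    using res_closed X Y f t by auto
  let ?ew = "res P.E A P.e w"
  have ew: "?ew \<in> carrier (T P.E)"
    using res_closed[OF E A e w] .
  have "res P.D P.E j1 ?ew = res P.D Y P.p t"
    using res_compose[OF D E A j1 e w] res_compose[OF D Y A p i1(1) w] by (simp add: ej1 w1)
  also have "\<dots> = res P.D X \<psi> (res X Y f t)"
    using res_compose[OF D X Y \<psi> f t] by (simp add: p_eq)
  finally have 1: "res P.D P.E j1 ?ew = res P.D X \<psi> (res X Y f t)" .
  have 2: "res P.D P.E j2 ?ew = res P.D X \<psi> s"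
    using res_compose[OF D E A j2 e w] res_compose[OF D X A \<psi> i2(1) w] by (simp add: ej2 w2)
  have "nm P.E P.D P.r ?ew = res P.D X \<psi> (res X Y f t) \<otimes>\<^bsub>T P.D\<^esub> res P.D X \<psi> s"
    using decomposition_nm[OF dE D r ew] nm_id[OF D] res_closed[OF D X \<psi>] ft s
    by (simp add: rj 1 2)
  also have "\<dots> = res P.D X \<psi> (res X Y f t \<otimes>\<^bsub>T X\<^esub> s)"
    using res_mult[OF D X \<psi> ft s] by simp
  finally have 3: "nm P.E P.D P.r ?ew = res P.D X \<psi> (res X Y f t \<otimes>\<^bsub>T X\<^esub> s)" .
  have fts: "res X Y f t \<otimes>\<^bsub>T X\<^esub> s \<in> carrier (T X)"
    using ft s by simp
  have "nm B Y h (tr A B q w) = tr P.D Y P.p (res P.D X \<psi> (res X Y f t \<otimes>\<^bsub>T X\<^esub> s))"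
    using nm_tr_dep_prod[OF P.dep_prod_axioms w] 3 by simp
  also have "\<dots> = tr X Y f (res X Y f t \<otimes>\<^bsub>T X\<^esub> s)"
    using tr_compose[OF D X Y \<psi> f res_closed[OF D X \<psi> fts]] tr_iso_res[OF D X \<psi> bij fts]
    by (simp flip: p_eq)
  finally show ?thesis
    using lhs by simp
qed

end

section \<open>Orbits\<close>

context group
begin

definition coset_pt :: "'a set \<Rightarrow> 'a \<Rightarrow> 'a point" where
  "coset_pt H a = Coset_pt (a <# H)"

lemma coset_pt_one: "subgroup H G \<Longrightarrow> coset_pt H \<one> = Coset_pt H"
  by (simp add: coset_pt_def l_coset_def subgroup.subset image_def) (use subgroup.subset in force)

lemma coset_pt_eq_iff:
  assumes H: "subgroup H G" and "a \<in> carrier G" "b \<in> carrier G"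
  shows "coset_pt H a = coset_pt H b \<longleftrightarrow> inv a \<otimes> b \<in> H"
proof
  assume "coset_pt H a = coset_pt H b"
  then have "b \<in> a <# H"
    using lcos_self[OF assms(3) H] by (simp add: coset_pt_def)
  then show "inv a \<otimes> b \<in> H"
    using subgroup.lcos_module_imp[OF H is_group] assms by blast
next
  assume "inv a \<otimes> b \<in> H"
  then have "b \<in> a <# H"
    using subgroup.lcos_module_rev[OF H is_group assms(2,3)] by blast
  then show "coset_pt H a = coset_pt H b"
    using l_repr_independence[OF _ assms(2) H] by (simp add: coset_pt_def)
qed

lemma pts_orbit: "pts (orbit_gset G H) = coset_pt H ` carrier G"
  by (auto simp: orbit_gset_def LCOSETS_def coset_pt_def)

lemma coset_pt_closed [simp]: "a \<in> carrier G \<Longrightarrow> coset_pt H a \<in> pts (orbit_gset G H)"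
  by (simp add: pts_orbit)

lemma orbit_cases:
  assumes "p \<in> pts (orbit_gset G H)"
  obtains a where "a \<in> carrier G" "p = coset_pt H a"
  using assms by (auto simp: pts_orbit)

lemma act_orbit [simp]:
  assumes "subgroup H G" "g \<in> carrier G" "a \<in> carrier G"
  shows "act (orbit_gset G H) g (coset_pt H a) = coset_pt H (g \<otimes> a)"
proof -
  have "coset_pt H a \<in> Coset_pt ` (lcosets H)"
    using assms(3) by (auto simp: coset_pt_def LCOSETS_def)
  then show ?thesis
    using lcos_m_assoc[OF subgroup.subset[OF assms(1)] assms(2,3)]
    by (simp add: orbit_gset_def) (simp add: coset_pt_def)
qed

lemma fin_gset_orbit:
  assumes H: "subgroup H G" and fin: "finite (carrier G)"
  shows "fin_gset G (orbit_gset G H)"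
proof (rule fin_gsetI)
  show "act (orbit_gset G H) g \<in> extensional (pts (orbit_gset G H))" for g
    by (simp add: orbit_gset_def)
qed (use assms in \<open>auto simp: pts_orbit m_assoc\<close>)

lemma orbit_proj_coset_pt [simp]:
  assumes H: "subgroup H G" and K: "subgroup K G" and "H \<subseteq> K" and a: "a \<in> carrier G"
  shows "orbit_proj G H K (coset_pt H a) = coset_pt K a"
proof -
  have sub: "H \<subseteq> carrier G" "K \<subseteq> carrier G"
    using H K subgroup.subset by auto
  have "H <#> K = K"
  proof (intro equalityI subsetI)
    show "x \<in> K" if "x \<in> H <#> K" for x
      using that assms(3) subgroup.m_closed[OF K] by (auto simp: set_mult_def)
    show "x \<in> H <#> K" if "x \<in> K" for x
      using that sub subgroup.one_closed[OF H] by (force simp: set_mult_def)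
  qed
  then have "(a <# H) <#> K = a <# K"
    using set_mult_assoc[of "{a}" H K] sub a by (simp add: l_coset_eq_set_mult)
  then show ?thesis
    using coset_pt_closed[OF a, of H] by (simp add: orbit_proj_def) (simp add: coset_pt_def)
qed

lemma orbit_proj_gmaps:
  assumes H: "subgroup H G" and K: "subgroup K G" and "H \<subseteq> K"
  shows "orbit_proj G H K \<in> gmaps G (orbit_gset G H) (orbit_gset G K)"
proof (rule gmapsI)
  show "orbit_proj G H K \<in> extensional (pts (orbit_gset G H))"
    by (simp add: orbit_proj_def)
qed (use assms in \<open>auto elim!: orbit_cases\<close>)

lemma orbit_proj_refl:
  assumes "subgroup H G"
  shows "orbit_proj G H H = (\<lambda>p\<in>pts (orbit_gset G H). p)"
proof (rule extensionalityI[where A = "pts (orbit_gset G H)"])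
  show "orbit_proj G H H \<in> extensional (pts (orbit_gset G H))"
    by (simp add: orbit_proj_def)
qed (use assms in \<open>auto elim!: orbit_cases\<close>)

lemma orbit_proj_trans:
  assumes "subgroup H G" "subgroup M G" "subgroup K G" "H \<subseteq> M" "M \<subseteq> K"
  shows "compose (pts (orbit_gset G H)) (orbit_proj G M K) (orbit_proj G H M) = orbit_proj G H K"
proof (rule extensionalityI[OF compose_extensional])
  show "orbit_proj G H K \<in> extensional (pts (orbit_gset G H))"
    by (simp add: orbit_proj_def)
qed (use assms in \<open>auto elim!: orbit_cases simp: compose_eq\<close>)

lemma fibre_orbit_proj:
  assumes H: "subgroup H G" and K: "subgroup K G" and HK: "H \<subseteq> K"
  shows "fibre (orbit_gset G H) (orbit_proj G H K) (Coset_pt K) = coset_pt H ` K"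
proof -
  have "coset_pt K a = coset_pt K \<one> \<longleftrightarrow> a \<in> K" if "a \<in> carrier G" for a
    using that subgroup.m_inv_closed[OF K, of a] subgroup.m_inv_closed[OF K, of "inv a"]
    by (auto simp: coset_pt_eq_iff[OF K])
  then show ?thesis
    using subgroup.mem_carrier[OF K] assms
    by (auto simp: fibre_def coset_pt_one[OF K, symmetric] elim!: orbit_cases)
qed

lemma card_fibre_orbit_proj:
  assumes "subgroup H G" "subgroup K G" "H \<subseteq> K"
  shows "card (fibre (orbit_gset G H) (orbit_proj G H K) (Coset_pt K)) = sub_index G K H"
proof -
  have "lcosets\<^bsub>G\<lparr>carrier := K\<rparr>\<^esub> H = (\<lambda>k. k <# H) ` K"
    by (auto simp: LCOSETS_def l_coset_def)
  moreover have "coset_pt H ` K = Coset_pt ` (\<lambda>k. k <# H) ` K"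
    by (simp add: coset_pt_def image_image)
  ultimately show ?thesis
    by (simp add: fibre_orbit_proj[OF assms] sub_index_def card_image inj_on_def)
qed

section \<open>Indices of subgroups\<close>

lemma sub_index_mult_card:
  assumes "subgroup H G" "subgroup K G" "H \<subseteq> K" "finite (carrier G)"
  shows "sub_index G K H * card H = card K"
proof -
  interpret K: group "G\<lparr>carrier := K\<rparr>"
    using assms(2) subgroup_imp_group by blast
  have "finite K"
    using assms(2,4) subgroup.subset finite_subset by blast
  then show ?thesis
    using K.l_lagrange[of H] subgroup_incl[OF assms(1,2,3)] by (simp add: sub_index_def order_def)
qed

lemma card_subgroup_pos: "subgroup H G \<Longrightarrow> finite (carrier G) \<Longrightarrow> 0 < card H"
  using subgroup.finite_imp_card_positive by blast

lemma sub_index_pos: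
  assumes "subgroup H G" "subgroup K G" "H \<subseteq> K" "finite (carrier G)"
  shows "0 < sub_index G K H"
  using sub_index_mult_card[OF assms] card_subgroup_pos[OF assms(2,4)] by (cases "sub_index G K H") auto

lemma sub_index_trans:
  assumes "subgroup H G" "subgroup M G" "subgroup K G" "H \<subseteq> M" "M \<subseteq> K" "finite (carrier G)"
  shows "sub_index G K H = sub_index G K M * sub_index G M H"
proof -
  have "sub_index G K H * card H = sub_index G K M * sub_index G M H * card H"
    using sub_index_mult_card[of H K] sub_index_mult_card[of M K] sub_index_mult_card[of H M] assms
    by (simp add: mult.assoc)
  then show ?thesis
    using card_subgroup_pos[OF assms(1,6)] by simp
qed

lemma sub_index_self:
  assumes "subgroup H G" "finite (carrier G)"
  shows "sub_index G H H = 1"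
  using sub_index_mult_card[OF assms(1,1) subset_refl assms(2)] card_subgroup_pos[OF assms] by simp

section \<open>Orbits of points and their stabilizers\<close>

lemma stabilizer_subgroup_gset: "fin_gset G X \<Longrightarrow> x \<in> pts X \<Longrightarrow> subgroup (stabilizer G (act X) x) G"
  unfolding fin_gset_def by (blast intro: group_action.stabilizer_subgroup)

lemma act_eq_iff:
  assumes X: "fin_gset G X" and x: "x \<in> pts X" and a: "a \<in> carrier G" and b: "b \<in> carrier G"
  shows "act X a x = act X b x \<longleftrightarrow> inv a \<otimes> b \<in> stabilizer G (act X) x"
proof -
  have "act X (inv a \<otimes> b) x = x \<longleftrightarrow> act X a x = act X b x"
    using act_mult[OF X _ b x, of "inv a"] act_inv[OF X a x] act_inv[OF X a act_closed[OF X b x]] a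
    by (metis inv_closed)
  then show ?thesis
    using a b by (simp add: stabilizer_def)
qed

text \<open>The orbit-stabilizer map \<open>aL \<mapsto> ax\<close>; by \<open>act_eq_iff\<close>
  the result is the same for every representative.\<close>

definition orbit_map :: "('a, 'x) gset \<Rightarrow> 'x \<Rightarrow> 'a point \<Rightarrow> 'x" where
  "orbit_map X x = (\<lambda>p\<in>pts (orbit_gset G (stabilizer G (act X) x)).
     act X (SOME a. a \<in> carrier G \<and> p = coset_pt (stabilizer G (act X) x) a) x)"

lemma orbit_map_coset_pt [simp]:
  assumes X: "fin_gset G X" and x: "x \<in> pts X" and a: "a \<in> carrier G"
  shows "orbit_map X x (coset_pt (stabilizer G (act X) x) a) = act X a x"
proof -
  let ?L = "stabilizer G (act X) x"
  let ?b = "SOME b. b \<in> carrier G \<and> coset_pt ?L a = coset_pt ?L b"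
  have "?b \<in> carrier G \<and> coset_pt ?L a = coset_pt ?L ?b"
    by (rule someI) (use a in simp)
  then have "act X a x = act X ?b x"
    using act_eq_iff[OF X x a] coset_pt_eq_iff[OF stabilizer_subgroup_gset[OF X x] a] by blast
  then show ?thesis
    using a by (simp add: orbit_map_def)
qed

lemma orbit_map_gmaps:
  assumes X: "fin_gset G X" and x: "x \<in> pts X"
  shows "orbit_map X x \<in> gmaps G (orbit_gset G (stabilizer G (act X) x)) X"
proof (rule gmapsI)
  show "orbit_map X x \<in> extensional (pts (orbit_gset G (stabilizer G (act X) x)))"
    by (simp add: orbit_map_def)
qed (use assms stabilizer_subgroup_gset[OF X x] in
    \<open>auto elim!: orbit_cases simp: act_closed act_mult\<close>)

lemma inj_on_orbit_map:
  assumes X: "fin_gset G X" and x: "x \<in> pts X"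
  shows "inj_on (orbit_map X x) (pts (orbit_gset G (stabilizer G (act X) x)))"
  by (rule inj_onI)
    (use assms in \<open>auto elim!: orbit_cases
      simp: act_eq_iff coset_pt_eq_iff[OF stabilizer_subgroup_gset[OF X x]]\<close>)

lemma image_orbit_map:
  assumes X: "fin_gset G X" and x: "x \<in> pts X"
  shows "orbit_map X x ` pts (orbit_gset G (stabilizer G (act X) x)) = (\<lambda>a. act X a x) ` carrier G"
  using assms by (auto simp: pts_orbit image_image)

text \<open>An element that fixes \<open>a\<close> fixes its image, and the stabilizer of the base
  point of \<open>G/K\<close> is \<open>K\<close>. Hence an orbit through the fibre over
  \<open>K\<close> is isomorphic to some \<open>G/L\<close> with \<open>L\<close> inside
  \<open>K\<close>, and its map to \<open>G/K\<close> becomes the projection.\<close>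

lemma stabilizer_subset_of_fibre:
  assumes K: "subgroup K G" and A: "fin_gset G A" and f: "f \<in> gmaps G A (orbit_gset G K)"
    and a: "a \<in> fibre A f (Coset_pt K)"
  shows "stabilizer G (act A) a \<subseteq> K"
proof
  fix g assume g: "g \<in> stabilizer G (act A) a"
  then have gG: "g \<in> carrier G" and "act A g a = a"
    by (auto simp: stabilizer_def)
  moreover have aA: "a \<in> pts A" and fa: "f a = coset_pt K \<one>"
    using a by (auto simp: fibre_def coset_pt_one[OF K])
  ultimately have "coset_pt K g = coset_pt K \<one>"
    using gmaps_act[OF f gG aA] K by simp
  then show "g \<in> K"
    using gG coset_pt_eq_iff[OF K _ gG, of \<one>] by simp
qed

end

section \<open>Transfers of one over an orbit\<close>

locale finite_tambara_functor = tambara_functor +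
  assumes finite_carrier: "finite (carrier G)"
begin

abbreviation tr_one where
  "tr_one K H \<equiv> tr (orbit_gset G H) (orbit_gset G K) (orbit_proj G H K) \<one>\<^bsub>T (orbit_gset G H)\<^esub>"

lemma tr_one_closed:
  "\<lbrakk>subgroup H G; subgroup K G; H \<subseteq> K\<rbrakk> \<Longrightarrow> tr_one K H \<in> carrier (T (orbit_gset G K))"
  by (intro tr_closed fin_gset_orbit orbit_proj_gmaps one_closed_T finite_carrier)

text \<open>The arguments of \<open>\<Phi>\<close> are the transfer of one, the number of points of the fibre over \<open>K\<close> and
  the number of \<open>K\<close>-fixed points in it.\<close>

lemma orbit_decomposition_induct:
  assumes K: "subgroup K G"
    and zero: "\<Phi> \<zero>\<^bsub>T (orbit_gset G K)\<^esub> 0 0"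
    and step: "\<And>\<tau> c w L. \<lbrakk>\<Phi> \<tau> c w; \<tau> \<in> carrier (T (orbit_gset G K)); subgroup L G; L \<subseteq> K; Q L\<rbrakk> \<Longrightarrow>
      \<Phi> (tr_one K L \<oplus>\<^bsub>T (orbit_gset G K)\<^esub> \<tau>) (sub_index G K L + c) ((if L = K then 1 else 0) + w)"
    and "fin_gset G A" "f \<in> gmaps G A (orbit_gset G K)"
    and "\<And>a. a \<in> fibre A f (Coset_pt K) \<Longrightarrow> Q (stabilizer G (act A) a)"
  shows "\<Phi> (tr A (orbit_gset G K) f \<one>\<^bsub>T A\<^esub>) (card (fibre A f (Coset_pt K)))
    (card {a \<in> fibre A f (Coset_pt K). \<forall>k\<in>K. act A k a = a})"
  using assms(4-6)
proof (induction "card (pts A)" arbitrary: A f rule: less_induct)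
  case less
  note A = less.prems(1) and f = less.prems(2) and Q = less.prems(3)
  let ?B = "orbit_gset G K" and ?b = "Coset_pt K"
  note B = fin_gset_orbit[OF K finite_carrier]
  show ?case
  proof (cases "fibre A f ?b = {}")
    case True
    \<comment> \<open>\<open>G/K\<close> is a single orbit, so every point of \<open>A\<close> has a
      translate in the fibre over \<open>K\<close>.\<close>
    have "pts A = {}"
    proof (rule ccontr)
      assume "pts A \<noteq> {}"
      then obtain x where x: "x \<in> pts A" by blast
      then obtain g where g: "g \<in> carrier G" "f x = coset_pt K g"
        using gmaps_closed[OF f] by (blast elim: orbit_cases)
      then have "act A (inv g) x \<in> fibre A f ?b"
        using x A gmaps_act[OF f, of "inv g" x] K
        by (simp add: fibre_def act_closed flip: coset_pt_one)
      with True show False by simp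
    qed
    then have "\<one>\<^bsub>T A\<^esub> = \<zero>\<^bsub>T A\<^esub>"
      using empty[OF A] one_closed_T[OF A] by auto
    then show ?thesis
      using tr_zero[OF A B f] zero by (simp add: True)
  next
    case False
    then obtain a where a: "a \<in> fibre A f ?b" by blast
    then have aA: "a \<in> pts A" and fa: "f a = ?b"
      by (auto simp: fibre_def)
    define L where "L = stabilizer G (act A) a"
    define i where "i = orbit_map A a"
    \<comment> \<open>The complement of the orbit of \<open>a\<close>: invariant again, and smaller
      because \<open>a\<close> is missing.\<close>
    define S where "S = pts A - (\<lambda>g. act A g a) ` carrier G"
    define A' where "A' = sub_gset A S"
    define j where "j = (\<lambda>x\<in>S. x)"
    let ?C = "orbit_gset G L"
    have L: "subgroup L G" and LK: "L \<subseteq> K" and QL: "Q L"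
      using stabilizer_subgroup_gset[OF A aA] stabilizer_subset_of_fibre[OF K A f a] Q[OF a]
      by (auto simp: L_def)
    note C = fin_gset_orbit[OF L finite_carrier]
    have i: "i \<in> gmaps G ?C A" and inj_i: "inj_on i (pts ?C)"
      and im_i: "i ` pts ?C = (\<lambda>g. act A g a) ` carrier G"
      and i_pt: "i (coset_pt L g) = act A g a" if "g \<in> carrier G" for g
      using orbit_map_gmaps[OF A aA] inj_on_orbit_map[OF A aA] image_orbit_map[OF A aA]
        orbit_map_coset_pt[OF A aA] that by (auto simp: i_def L_def)
    \<comment> \<open>The premise on \<open>g\<close> was attached to all four facts above; it stays
      with \<open>i_pt\<close>, and the other three are freed of it by taking \<open>g\<close> to be
      the unit.\<close>
    note i = i[OF one_closed] and inj_i = inj_i[OF one_closed] and im_i = im_i[OF one_closed]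
    have SA: "S \<subseteq> pts A"
      by (auto simp: S_def)
    have act_S: "act A g x \<in> S" if g: "g \<in> carrier G" and x: "x \<in> S" for g x
    proof -
      have xA: "x \<in> pts A" using x SA by blast
      have False if "act A g x = act A h a" "h \<in> carrier G" for h
      proof -
        have "x = act A (inv g \<otimes> h) a"
          using that g act_inv(1)[OF A g xA] by (simp add: act_mult[OF A _ _ aA])
        then show False
          using x g that by (auto simp: S_def)
      qed
      then show ?thesis
        using act_closed[OF A g xA] by (auto simp: S_def)
    qed
    have A': "fin_gset G A'" and j: "j \<in> gmaps G A' A"
      using fin_gset_sub_gset[OF A SA] incl_gmaps[OF A SA] act_S by (auto simp: A'_def j_def)
    have ptsA': "pts A' = S" and im_j: "j ` pts A' = S"
      by (auto simp: A'_def j_def)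
    have "inj_on j (pts A')"
      by (simp add: j_def ptsA' inj_on_def)
    moreover have "i ` pts ?C \<inter> j ` pts A' = {}" and un: "i ` pts ?C \<union> j ` pts A' = pts A"
      using act_closed[OF A _ aA] SA unfolding im_i im_j by (auto simp: S_def)
    ultimately have d: "decomposition ?C i A' j A"
      unfolding decomposition_def using A A' C i j inj_i by blast
    define f' where "f' = compose (pts A') f j"
    have f': "f' \<in> gmaps G A' ?B"
      using compose_gmaps[OF A' j f] by (simp add: f'_def)
    have f'_eq: "f' x = f x" if "x \<in> S" for x
      using that by (simp add: f'_def compose_def ptsA' j_def)
    have fi: "compose (pts ?C) f i = orbit_proj G L K"
    proof (rule gmaps_eqI[OF compose_gmaps[OF C i f] orbit_proj_gmaps[OF L K LK]])
      fix p assume "p \<in> pts ?C"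
      then obtain g where g: "g \<in> carrier G" "p = coset_pt L g"
        by (elim orbit_cases)
      then have "f (act A g a) = coset_pt K g"
        using gmaps_act[OF f g(1) aA] fa K by (simp flip: coset_pt_one)
      then show "compose (pts ?C) f i p = orbit_proj G L K p"
        using g i_pt L K LK by (simp add: compose_eq)
    qed
    have tr_eq: "tr A ?B f \<one>\<^bsub>T A\<^esub> = tr_one K L \<oplus>\<^bsub>T ?B\<^esub> tr A' ?B f' \<one>\<^bsub>T A'\<^esub>"
      using decomposition_tr[OF d B f one_closed_T[OF A]] res_one[OF C A i] res_one[OF A' A j]
      by (simp add: fi f'_def)
    let ?F = "fibre A f ?b" and ?F' = "fibre A' f' ?b"
    let ?O = "i ` fibre ?C (orbit_proj G L K) ?b"
    have finF: "finite ?F"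
      using fin_gset_finite[OF A] by (simp add: fibre_def)
    have F'_eq: "?F' = ?F \<inter> S"
      using SA by (auto simp: fibre_def ptsA' f'_eq)
    have "?O = ?F \<inter> i ` pts ?C"
    proof -
      have "orbit_proj G L K p = f (i p)" if "p \<in> pts ?C" for p
        using that by (simp add: compose_eq flip: fi)
      then show ?thesis
        using gmaps_closed[OF i] by (auto simp: fibre_def)
    qed
    then have F_eq: "?F = ?O \<union> ?F'" and disj: "?O \<inter> ?F' = {}"
      using un \<open>i ` pts ?C \<inter> j ` pts A' = {}\<close> unfolding F'_eq im_j by (auto simp: fibre_def)
    have card_O: "card ?O = sub_index G K L"
      using card_fibre_orbit_proj[OF L K LK] inj_on_subset[OF inj_i, of "fibre ?C (orbit_proj G L K) ?b"]
      by (simp add: card_image fibre_def)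
    have c_eq: "card ?F = sub_index G K L + card ?F'"
      using card_Un_disjoint[of ?O ?F'] finF F_eq disj card_O by (metis finite_Un)
    have KG: "k \<in> carrier G" if "k \<in> K" for k
      using that subgroup.mem_carrier[OF K] by blast
    let ?W = "{x \<in> ?F. \<forall>k\<in>K. act A k x = x}" and ?W' = "{x \<in> ?F'. \<forall>k\<in>K. act A' k x = x}"
    have act_F': "act A' k x = act A k x" if "x \<in> ?F'" for k x
      using that F'_eq by (simp add: A'_def)
    then have "?W' = {x \<in> ?F'. \<forall>k\<in>K. act A k x = x}"
      by auto
    then have W_eq: "?W = {x \<in> ?O. \<forall>k\<in>K. act A k x = x} \<union> ?W'"
      using F_eq by blast
    have O_eq: "?O = (\<lambda>k. act A k a) ` K"
      using KG i_pt by (simp add: fibre_orbit_proj[OF L K LK] image_image)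
    \<comment> \<open>If \<open>ka\<close> is fixed by all of \<open>K\<close>, it is fixed by
      \<open>inv k\<close>, so \<open>ka = a\<close>. Thus the orbit \<open>K/L\<close> contains a
      fixed point only for \<open>L = K\<close>, and then it is that point.\<close>
    have WO: "{x \<in> ?O. \<forall>k\<in>K. act A k x = x} = (if L = K then {a} else {})"
    proof (cases "L = K")
      case True
      then have "act A k a = a" if "k \<in> K" for k
        using that by (auto simp: L_def stabilizer_def)
      then show ?thesis
        unfolding O_eq using True subgroup.one_closed[OF K] by auto
    next
      case False
      have "L = K" if k: "k \<in> K" and fixd: "\<forall>k'\<in>K. act A k' (act A k a) = act A k a" for k
      proof -
        have "act A (inv k) (act A k a) = act A k a"
          using fixd subgroup.m_inv_closed[OF K k] by blast
        then have "act A k a = a"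
          using act_inv(1)[OF A KG[OF k] aA] by simp
        then have "K \<subseteq> L"
          using fixd KG by (auto simp: L_def stabilizer_def)
        with LK show ?thesis by blast
      qed
      with False show ?thesis
        unfolding O_eq by auto
    qed
    have w_eq: "card ?W = (if L = K then 1 else 0) + card ?W'"
    proof -
      have "{x \<in> ?O. \<forall>k\<in>K. act A k x = x} \<inter> ?W' = {}"
        using disj by blast
      moreover have "finite ?W'"
        using finF F'_eq by auto
      moreover have "finite {x \<in> ?O. \<forall>k\<in>K. act A k x = x}"
        unfolding WO by auto
      ultimately show ?thesis
        unfolding W_eq WO by (subst card_Un_disjoint) auto
    qed
    have "a \<notin> S"
      using act_one[OF A aA] one_closed by (force simp: S_def)
    then have "S \<subset> pts A"
      using SA aA by blast
    then have "card (pts A') < card (pts A)"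
      using psubset_card_mono[OF fin_gset_finite[OF A]] by (simp add: ptsA')
    moreover have "Q (stabilizer G (act A') x)" if "x \<in> ?F'" for x
    proof -
      have "stabilizer G (act A') x = stabilizer G (act A) x"
        using act_F'[OF that] by (simp add: stabilizer_def)
      then show ?thesis
        using Q[of x] that by (simp add: F'_eq)
    qed
    ultimately have "\<Phi> (tr A' ?B f' \<one>\<^bsub>T A'\<^esub>) (card ?F') (card ?W')"
      using less.hyps[OF _ A' f'] by blast
    then show ?thesis
      unfolding tr_eq c_eq w_eq
      using step[OF _ tr_closed[OF A' B f' one_closed_T[OF A']] L LK QL] by blast
  qed
qed

end

section \<open>The norm of a transfer of one\<close>

definition (in group) fixed_fibre :: "'a set \<Rightarrow> 'a set \<Rightarrow> 'a point set" where
  "fixed_fibre K H =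
    {a \<in> coset_pt H ` K. \<forall>h\<in>H. act (orbit_gset G H) h a = a}"

context finite_tambara_functor
begin

text \<open>Base change turns the restricted transfer into the transfer of one along
  \<open>q\<close>. The law for norms of transfers moves the transfer outside, and restriction and
  norm preserve one. The fibre of the dependent product over \<open>K\<close> consists of the maps
  from \<open>K/H\<close> to itself, which gives the count.\<close>

lemma nm_res_tr_one:
  assumes H: "subgroup H G" and K: "subgroup K G" and HK: "H \<subseteq> K"
  defines "X \<equiv> orbit_gset G H" and "B \<equiv> orbit_gset G K" and "f \<equiv> orbit_proj G H K"
  defines "A \<equiv> pullback_gset X f X f" and "q \<equiv> pullback_snd X f X f"
  shows "dep_prod G A X B q f"
    and "nm X B f (res X B f (tr_one K H)) =
      tr (dep_prod_gset G A q X f B) B (dep_prod_proj G A q X f B) \<one>\<^bsub>T (dep_prod_gset G A q X f B)\<^esub>"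
    and "card (fibre (dep_prod_gset G A q X f B) (dep_prod_proj G A q X f B) (Coset_pt K)) =
      sub_index G K H ^ sub_index G K H"
proof -
  note X = fin_gset_orbit[OF H finite_carrier, folded X_def]
    and B = fin_gset_orbit[OF K finite_carrier, folded B_def]
    and f = orbit_proj_gmaps[OF H K HK, folded X_def B_def f_def]
  note A = fin_gset_pullback[OF X X f f, folded A_def]
    and fstX = pullback_fst_gmaps[OF X X f f, folded A_def]
    and q = pullback_snd_gmaps[OF X X f f, folded A_def q_def]
  show dp: "dep_prod G A X B q f"
    by unfold_locales (use A X B q f in auto)
  then interpret dep_prod G A X B q f .
  have "res X B f (tr X B f \<one>\<^bsub>T X\<^esub>) = tr A X q \<one>\<^bsub>T A\<^esub>"
    using res_tr[OF X B X f f one_closed_T[OF X]] res_one[OF A X fstX]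
    by (simp add: A_def q_def)
  then show "nm X B f (res X B f (tr_one K H)) = tr D B p \<one>\<^bsub>T D\<^esub>"
    using nm_tr_dep_prod[OF dp one_closed_T[OF A]] res_one[OF fin_gset_E A e_gmaps]
      nm_one[OF fin_gset_E fin_gset_D r_gmaps]
    by (simp add: X_def B_def f_def)
  have b: "Coset_pt K \<in> pts B"
    using coset_pt_closed[OF one_closed, of K] coset_pt_one[OF K] by (simp add: B_def)
  have "card (fibre A q x) = sub_index G K H" if "x \<in> F (Coset_pt K)" for x
  proof -
    have "x \<in> pts X" "f x = Coset_pt K"
      using that by (auto simp: fibre_def)
    then show ?thesis
      using card_fibre_pullback_snd[of x X X f f] card_fibre_orbit_proj[OF H K HK]
      by (simp add: A_def q_def) (simp add: X_def f_def)
  qed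
  then have "card (fibre D p (Coset_pt K)) = sub_index G K H ^ card (F (Coset_pt K))"
    by (simp add: card_fibre_p[OF b])
  then show "card (fibre D p (Coset_pt K)) = sub_index G K H ^ sub_index G K H"
    using card_fibre_orbit_proj[OF H K HK] by (simp add: X_def f_def)
qed

text \<open>A section over the fibre \<open>K/H\<close> of \<open>G/H \<rightarrow> G/K\<close> is a map \<open>K/H \<rightarrow> K/H\<close>; it is fixed by \<open>K\<close> iff it
  is equivariant, hence determined by the image of \<open>H\<close>, an \<open>H\<close>-fixed point of \<open>K/H\<close>.\<close>

lemma card_fixed_dep_prod:
  assumes H: "subgroup H G" and K: "subgroup K G" and HK: "H \<subseteq> K"
  defines "X \<equiv> orbit_gset G H" and "B \<equiv> orbit_gset G K" and "f \<equiv> orbit_proj G H K"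
  defines "A \<equiv> pullback_gset X f X f" and "q \<equiv> pullback_snd X f X f"
  defines "D \<equiv> dep_prod_gset G A q X f B" and "p \<equiv> dep_prod_proj G A q X f B"
  shows card_fixed_eq: "card {d \<in> fibre D p (Coset_pt K). \<forall>k\<in>K. act D k d = d} = card (fixed_fibre K H)"
    and stabilizer_supset: "\<lbrakk>fixed_fibre K H = coset_pt H ` K; d \<in> fibre D p (Coset_pt K)\<rbrakk> \<Longrightarrow>
      H \<subseteq> stabilizer G (act D) d"
proof -
  note X = fin_gset_orbit[OF H finite_carrier, folded X_def]
    and B = fin_gset_orbit[OF K finite_carrier, folded B_def]
    and f = orbit_proj_gmaps[OF H K HK, folded X_def B_def f_def]
  interpret dep_prod G A X B q f
    using nm_res_tr_one(1)[OF H K HK] by (simp add: X_def B_def f_def A_def q_def)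
  let ?b = "Coset_pt K" and ?e = "Coset_pt H"
  have KG: "k \<in> carrier G" if "k \<in> K" for k
    using that subgroup.mem_carrier[OF K] by blast
  have b: "?b \<in> pts B" "?b = coset_pt K \<one>"
    using coset_pt_closed[OF one_closed, of K] coset_pt_one[OF K] by (simp_all add: B_def)
  have act_b: "act B k ?b = ?b" if "k \<in> K" for k
  proof -
    have "coset_pt K k = coset_pt K \<one>"
      using coset_pt_eq_iff[OF K KG[OF that] one_closed] subgroup.m_inv_closed[OF K that] KG[OF that]
      by simp
    then show ?thesis
      using K KG[OF that] by (simp add: B_def b(2))
  qed
  have Fb: "F ?b = coset_pt H ` K"
    using fibre_orbit_proj[OF H K HK] by (simp add: X_def f_def)
  have e: "?e \<in> F ?b"
    using subgroup.one_closed[OF K] coset_pt_one[OF H] by (force simp: Fb)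
  have act_pt: "act X g (coset_pt H a) = coset_pt H (g \<otimes> a)" if "g \<in> carrier G" "a \<in> carrier G" for g a
    using that H by (simp add: X_def)
  have pt_act: "coset_pt H k = act X k ?e" if "k \<in> K" for k
    using act_pt[OF KG[OF that] one_closed] KG[OF that] coset_pt_one[OF H] by simp
  have F_pts: "x \<in> pts X" "f x = ?b" if "x \<in> F ?b" for x
    using that by (auto simp: fibre_def)
  \<comment> \<open>So a section is \<open>x \<mapsto> (u x, x)\<close> for a map \<open>u\<close>
    from \<open>K/H\<close> to itself.\<close>
  have fibq: "fibre A q x = (\<lambda>u. Tup u x) ` F ?b" if "x \<in> F ?b" for x
    using fibre_pullback_snd[of x X X f f] F_pts[OF that] by (simp add: A_def q_def)
  have actA: "act A g (Tup u x) = Tup (act X g u) (act X g x)" if "u \<in> F ?b" "x \<in> F ?b" for g u x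
    using F_pts[OF that(1)] F_pts[OF that(2)] by (simp add: A_def)
  have act_F: "act X k x \<in> F ?b" if "k \<in> K" "x \<in> F ?b" for k x
    using act_fibre[OF X f KG[OF that(1)] that(2)] act_b[OF that(1)] by simp
  have conj: "act D k (pt ?b s) = pt ?b (conj_section k ?b s)" "conj_section k ?b s \<in> sections ?b"
    "conj_section k ?b s = (\<lambda>x\<in>F ?b. act A k (s (act X (inv k) x)))"
    if "k \<in> K" "s \<in> sections ?b" for k s
    using act_D[OF KG[OF that(1)] b(1) that(2)] conj_section[OF KG[OF that(1)] b(1) that(2)]
      act_b[OF that(1)] by (simp_all add: D_def conj_section_def)
  have fixed_iff: "act D k (pt ?b s) = pt ?b s \<longleftrightarrow> (\<forall>x\<in>F ?b. act A k (s (act X (inv k) x)) = s x)"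
    if ks: "k \<in> K" "s \<in> sections ?b" for k s
  proof -
    have "act D k (pt ?b s) = pt ?b s \<longleftrightarrow> conj_section k ?b s = s"
      using conj(1,2)[OF ks] pt_eq_iff[OF conj(2)[OF ks] ks(2)] by simp
    also have "\<dots> \<longleftrightarrow> (\<forall>x\<in>F ?b. conj_section k ?b s x = s x)"
      using conj(2)[OF ks] ks(2) by (auto intro: PiE_ext)
    finally show ?thesis
      by (simp add: conj(3)[OF ks])
  qed
  have fibD: "fibre D p ?b = pt ?b ` sections ?b"
    using fibre_p[OF b(1)] by (simp add: D_def p_def)
  let ?W = "{d \<in> fibre D p ?b. \<forall>k\<in>K. act D k d = d}"
  \<comment> \<open>The equivariant map \<open>kH \<mapsto> ka\<close>, well defined because
    \<open>a\<close> is fixed by \<open>H\<close>; \<open>\<sigma> a\<close> is the corresponding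
    section.\<close>
  define \<tau> where "\<tau> a x = act X (SOME k. k \<in> K \<and> x = coset_pt H k) a" for a x
  define \<sigma> where "\<sigma> a = (\<lambda>x\<in>F ?b. Tup (\<tau> a x) x)" for a
  have fixedD: "a \<in> F ?b" "\<And>h. h \<in> H \<Longrightarrow> act X h a = a" if "a \<in> fixed_fibre K H" for a
    using that unfolding fixed_fibre_def Fb by (auto simp: X_def)
  have \<tau>: "\<tau> a (coset_pt H k) = act X k a" if a: "a \<in> fixed_fibre K H" and k: "k \<in> K" for a k
  proof -
    let ?k = "SOME k'. k' \<in> K \<and> coset_pt H k = coset_pt H k'"
    have k': "?k \<in> K \<and> coset_pt H k = coset_pt H ?k"
      by (rule someI) (use k in simp)
    then have "inv k \<otimes> ?k \<in> stabilizer G (act X) a"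
      using coset_pt_eq_iff[OF H KG[OF k], of ?k] KG fixedD(2)[OF a] subgroup.mem_carrier[OF H]
      by (auto simp: stabilizer_def)
    then show ?thesis
      using act_eq_iff[OF X F_pts(1)[OF fixedD(1)[OF a]] KG[OF k], of ?k] KG k' by (simp add: \<tau>_def)
  qed
  have \<sigma>: "\<sigma> a \<in> sections ?b" if a: "a \<in> fixed_fibre K H" for a
  proof (rule PiE_I)
    fix x assume x: "x \<in> F ?b"
    then obtain k where "k \<in> K" "x = coset_pt H k" by (auto simp: Fb)
    then have "\<tau> a x \<in> F ?b"
      using \<tau>[OF a] act_F fixedD(1)[OF a] by simp
    then show "\<sigma> a x \<in> fibre A q x"
      using x by (simp add: \<sigma>_def fibq)
  qed (simp add: \<sigma>_def)
  have \<sigma>_W: "pt ?b (\<sigma> a) \<in> ?W" if a: "a \<in> fixed_fibre K H" for a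
  proof -
    have "act A k (\<sigma> a (act X (inv k) x)) = \<sigma> a x" if k: "k \<in> K" and x: "x \<in> F ?b" for k x
    proof -
      obtain l where l: "l \<in> K" "x = coset_pt H l"
        using x by (auto simp: Fb)
      have k': "inv k \<in> K" and kl: "inv k \<otimes> l \<in> K"
        using subgroup.m_inv_closed[OF K k] subgroup.m_closed[OF K _ l(1)] by auto
      have x': "act X (inv k) x = coset_pt H (inv k \<otimes> l)"
        using act_pt KG k' l by simp
      have aX: "a \<in> pts X"
        using F_pts fixedD(1)[OF a] by blast
      have "act X k (act X (inv k \<otimes> l) a) = act X l a"
        using act_mult[OF X KG[OF k'] KG[OF l(1)] aX] act_inv(2)[OF X KG[OF k]]
          act_closed[OF X KG[OF l(1)] aX] by simp
      moreover have "act X k (act X (inv k) x) = x"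
        using act_inv(2)[OF X KG[OF k] F_pts(1)[OF x]] .
      moreover have "act X (inv k) x \<in> F ?b"
        using act_F[OF k' x] .
      moreover have "act X (inv k \<otimes> l) a \<in> F ?b"
        using act_F[OF kl fixedD(1)[OF a]] .
      ultimately show ?thesis
        using x \<tau>[OF a kl] \<tau>[OF a l(1)] l(2) x' by (simp add: \<sigma>_def actA)
    qed
    then show ?thesis
      using \<sigma>[OF a] by (simp add: fibD fixed_iff)
  qed
  have "bij_betw (\<lambda>a. pt ?b (\<sigma> a)) (fixed_fibre K H) ?W"
  proof (rule bij_betwI')
    fix a a' assume a: "a \<in> fixed_fibre K H" and a': "a' \<in> fixed_fibre K H"
    have "a = a'" if "\<sigma> a = \<sigma> a'"
    proof -
      have "\<tau> a ?e = \<tau> a' ?e"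
        using fun_cong[OF that, of ?e] e by (simp add: \<sigma>_def)
      then show ?thesis
        using \<tau>[OF a subgroup.one_closed[OF K]] \<tau>[OF a' subgroup.one_closed[OF K]] coset_pt_one[OF H]
          act_one[OF X] F_pts(1) fixedD(1) a a' by metis
    qed
    then show "pt ?b (\<sigma> a) = pt ?b (\<sigma> a') \<longleftrightarrow> a = a'"
      using pt_eq_iff[OF \<sigma>[OF a] \<sigma>[OF a']] by auto
  next
    fix d assume "d \<in> ?W"
    then obtain s where d: "d = pt ?b s" and s: "s \<in> sections ?b"
      and fixd: "\<And>k x. k \<in> K \<Longrightarrow> x \<in> F ?b \<Longrightarrow> act A k (s (act X (inv k) x)) = s x"
      using fixed_iff by (auto simp: fibD)
    \<comment> \<open>An equivariant map is recovered from its value \<open>a\<close> at the coset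
      \<open>H\<close>, and \<open>a\<close> is fixed by \<open>H\<close> because that coset
      is.\<close>
    obtain a where a: "a \<in> F ?b" "s ?e = Tup a ?e"
      using s e fibq[OF e] by (auto simp: PiE_def Pi_def)
    have s_pt: "s (coset_pt H k) = Tup (act X k a) (coset_pt H k)" if k: "k \<in> K" for k
    proof -
      have "act X (inv k) (coset_pt H k) = ?e"
        using KG[OF k] act_pt[of "inv k" k] coset_pt_one[OF H] by simp
      moreover have "coset_pt H k \<in> F ?b"
        using k by (simp add: Fb)
      ultimately show ?thesis
        using fixd[OF k, of "coset_pt H k"] a(2) actA[OF a(1) e, of k] pt_act[OF k] by simp
    qed
    have "act X h a = a" if h: "h \<in> H" for h
    proof -
      have "coset_pt H h = ?e"
        using coset_pt_eq_iff[OF H, of h \<one>] subgroup.m_inv_closed[OF H h] subgroup.mem_carrier[OF H h]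
          coset_pt_one[OF H] by simp
      then show ?thesis
        using s_pt[of h] h HK a(2) by auto
    qed
    then have aH: "a \<in> fixed_fibre K H"
      using a(1) unfolding fixed_fibre_def Fb by (auto simp: X_def)
    have "s = \<sigma> a"
    proof (rule PiE_ext[OF s \<sigma>[OF aH]])
      fix x assume x: "x \<in> F ?b"
      then obtain k where "k \<in> K" "x = coset_pt H k" by (auto simp: Fb)
      with x show "s x = \<sigma> a x"
        using s_pt \<tau>[OF aH] by (simp add: \<sigma>_def)
    qed
    with d aH show "\<exists>a\<in>fixed_fibre K H. d = pt ?b (\<sigma> a)" by blast
  qed (rule \<sigma>_W)
  then show "card ?W = card (fixed_fibre K H)"
    by (rule bij_betw_same_card[symmetric])
  \<comment> \<open>If \<open>H\<close> fixes every point of \<open>K/H\<close>, conjugation by an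
    element of \<open>H\<close> changes neither the arguments nor the values of a section.\<close>
  assume triv: "fixed_fibre K H = coset_pt H ` K" and "d \<in> fibre D p ?b"
  then obtain s where d: "d = pt ?b s" and s: "s \<in> sections ?b"
    by (auto simp: fibD)
  have hF: "act X h x = x" if "h \<in> H" "x \<in> F ?b" for h x
    using fixedD(2) that triv by (simp add: Fb)
  show "H \<subseteq> stabilizer G (act D) d"
  proof
    fix h assume h: "h \<in> H"
    then have hK: "h \<in> K" and h': "inv h \<in> H"
      using HK subgroup.m_inv_closed[OF H] by auto
    have "act A h (s (act X (inv h) x)) = s x" if x: "x \<in> F ?b" for x
    proof -
      obtain u where "u \<in> F ?b" "s x = Tup u x"
        using s x fibq[OF x] by (auto simp: PiE_def Pi_def)
      then show ?thesis
        using hF[OF h'] hF[OF h] x by (simp add: actA)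
    qed
    then show "h \<in> stabilizer G (act D) d"
      using fixed_iff[OF hK s] KG[OF hK] by (simp add: stabilizer_def d)
  qed
qed

end

section \<open>Multiplicatively cohomological implies additively cohomological\<close>

definition (in group) maximal_in :: "'a set \<Rightarrow> 'a set \<Rightarrow> bool" where
  "maximal_in H K \<longleftrightarrow> subgroup H G \<and> subgroup K G \<and> H \<subset> K \<and>
    (\<forall>M. subgroup M G \<longrightarrow> H \<subseteq> M \<longrightarrow> M \<subseteq> K \<longrightarrow> M = H \<or> M = K)"

lemma (in group) obtain_maximal_in:
  assumes "finite (carrier G)" "subgroup H G" "subgroup K G" "H \<subset> K"
  obtains M where "maximal_in M K" "H \<subseteq> M"
proof -
  let ?S = "{M. subgroup M G \<and> H \<subseteq> M \<and> M \<subset> K}"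
  have "?S \<subseteq> Pow (carrier G)"
    using subgroup.subset by auto
  then have fin: "finite ?S"
    using assms(1) by (meson finite_Pow_iff finite_subset)
  have "H \<in> ?S"
    using assms by simp
  from finite_has_maximal2[OF fin this]
  obtain M where M: "M \<in> ?S" "H \<subseteq> M" and max: "\<forall>M'\<in>?S. M \<subseteq> M' \<longrightarrow> M = M'"
    by blast
  have "M' = M \<or> M' = K" if "subgroup M' G" "M \<subseteq> M'" "M' \<subseteq> K" for M'
  proof (cases "M' = K")
    case False
    then have "M' \<in> ?S"
      using that M(2) by blast
    with max that(2) show ?thesis by blast
  qed simp
  then have "maximal_in M K"
    using M assms(3) by (auto simp: maximal_in_def)
  with M(2) show ?thesis by (rule that[rotated])
qed

text \<open>The \<open>H\<close>-fixed points of \<open>K/H\<close> are the cosets in the normalizer of \<open>H\<close> in \<open>K\<close>.\<close>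

lemma (in group) fixed_fibre_maximal:
  assumes fin: "finite (carrier G)" and max: "maximal_in H K"
  shows "fixed_fibre K H = {Coset_pt H} \<or> fixed_fibre K H = coset_pt H ` K"
proof -
  have H: "subgroup H G" and K: "subgroup K G" and HK: "H \<subseteq> K"
    using max by (auto simp: maximal_in_def)
  have HG: "h \<in> carrier G" if "h \<in> H" for h
    using that subgroup.mem_carrier[OF H] by blast
  have KG: "k \<in> carrier G" if "k \<in> K" for k
    using that subgroup.mem_carrier[OF K] by blast
  define N where "N = {k \<in> K. \<forall>h\<in>H. inv k \<otimes> (h \<otimes> k) \<in> H}"
  have "act (orbit_gset G H) h (coset_pt H k) = coset_pt H k \<longleftrightarrow> inv k \<otimes> (h \<otimes> k) \<in> H"
    if "h \<in> H" "k \<in> K" for h k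
    using that H HG[OF that(1)] KG[OF that(2)] coset_pt_eq_iff[OF H KG[OF that(2)], of "h \<otimes> k"]
    by (metis act_orbit m_closed)
  then have fixed: "fixed_fibre K H = coset_pt H ` N"
    by (auto simp: fixed_fibre_def N_def)
  have "subgroup N G"
  proof (rule subgroupI)
    show "N \<subseteq> carrier G"
      using KG by (auto simp: N_def)
    show "N \<noteq> {}"
      using subgroup.one_closed[OF K] HG by (auto simp: N_def)
    fix k assume "k \<in> N"
    then have k: "k \<in> K" and conj: "\<And>h. h \<in> H \<Longrightarrow> inv k \<otimes> (h \<otimes> k) \<in> H"
      by (auto simp: N_def)
    show "inv k \<in> N"
      unfolding N_def
    proof (intro CollectI conjI ballI)
      show "inv k \<in> K"
        using subgroup.m_inv_closed[OF K k] .
      \<comment> \<open>\<open>N\<close> only demands that conjugation maps \<open>H\<close> into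
        itself. As \<open>H\<close> is finite, the map is then onto, which makes \<open>N\<close>
        closed under inverses.\<close>
      have "inj_on (\<lambda>h. inv k \<otimes> (h \<otimes> k)) H"
        using HG KG[OF k] by (auto simp: inj_on_def)
      then have "(\<lambda>h. inv k \<otimes> (h \<otimes> k)) ` H = H"
        using conj finite_subset[OF subgroup.subset[OF H] fin] by (intro endo_inj_surj) auto
      moreover fix h assume "h \<in> H"
      ultimately obtain h' where "h' \<in> H" "h = inv k \<otimes> (h' \<otimes> k)"
        by blast
      then have "inv (inv k) \<otimes> (h \<otimes> inv k) = h'"
        using HG KG[OF k] by (simp add: m_assoc) (simp flip: m_assoc)
      with \<open>h' \<in> H\<close> show "inv (inv k) \<otimes> (h \<otimes> inv k) \<in> H" by simp
    qed
    fix l assume "l \<in> N"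
    then have l: "l \<in> K" and conj': "\<And>h. h \<in> H \<Longrightarrow> inv l \<otimes> (h \<otimes> l) \<in> H"
      by (auto simp: N_def)
    have "inv (k \<otimes> l) \<otimes> (h \<otimes> (k \<otimes> l)) \<in> H" if h: "h \<in> H" for h
      using conj'[OF conj[OF h]] KG[OF k] KG[OF l] HG[OF h] by (simp add: inv_mult_group m_assoc)
    then show "k \<otimes> l \<in> N"
      using subgroup.m_closed[OF K k l] by (simp add: N_def)
  qed
  moreover have "H \<subseteq> N" "N \<subseteq> K"
    using HK subgroup.m_closed[OF H] subgroup.m_inv_closed[OF H] by (auto simp: N_def)
  \<comment> \<open>These are the self-normalizing and the normal case.\<close>
  ultimately have "N = H \<or> N = K"
    using max by (auto simp: maximal_in_def)
  moreover have "coset_pt H h = Coset_pt H" if "h \<in> H" for h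
    using coset_pt_eq_iff[OF H one_closed HG[OF that]] coset_pt_one[OF H] HG that by simp
  then have "coset_pt H ` H = {Coset_pt H}"
    using subgroup.one_closed[OF H] by auto
  ultimately show ?thesis
    using fixed by auto
qed

section \<open>Transfers of one as integers\<close>

context finite_tambara_functor
begin

lemma cring_orbit: "subgroup K G \<Longrightarrow> cring (T (orbit_gset G K))"
  by (intro cring fin_gset_orbit finite_carrier)

lemma tr_add_pow:
  fixes n :: nat
  assumes X: "fin_gset G X" and Y: "fin_gset G Y" and f: "f \<in> gmaps G X Y" and t: "t \<in> carrier (T X)"
  shows "tr X Y f (add_pow (T X) n t) = add_pow (T Y) n (tr X Y f t)"
proof -
  interpret RX: cring "T X" using cring X .
  interpret RY: cring "T Y" using cring Y .
  show ?thesis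
    using hom_nat_pow[OF tr_hom[OF X Y f] _ RX.a_group RY.a_group, of t n] t
    by (simp add: add_pow_def)
qed

lemma tr_one_self:
  assumes "subgroup K G"
  shows "tr_one K K = \<one>\<^bsub>T (orbit_gset G K)\<^esub>"
  using tr_id fin_gset_orbit[OF assms finite_carrier] one_closed_T
  by (simp add: orbit_proj_refl[OF assms])

lemma tr_one_trans:
  assumes "subgroup H G" "subgroup M G" "subgroup K G" "H \<subseteq> M" "M \<subseteq> K"
  shows "tr_one K H = tr (orbit_gset G M) (orbit_gset G K) (orbit_proj G M K) (tr_one M H)"
  using tr_compose[of "orbit_gset G H" "orbit_gset G M" "orbit_gset G K" "orbit_proj G H M" "orbit_proj G M K"]
    orbit_proj_trans[OF assms] assms fin_gset_orbit[OF _ finite_carrier] orbit_proj_gmaps one_closed_T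
  by simp

text \<open>\<open>counting K\<close> says that the map from the Burnside ring of \<open>K\<close> to \<open>T(G/K)\<close> counts points:
  a map \<open>A \<rightarrow> G/K\<close> of finite \<open>G\<close>-sets corresponds to the \<open>K\<close>-set which is its fibre over \<open>K\<close>.\<close>

definition counting :: "'a set \<Rightarrow> bool" where
  "counting K \<longleftrightarrow> (\<forall>A f. fin_gset G A \<longrightarrow> f \<in> gmaps G A (orbit_gset G K) \<longrightarrow>
    tr A (orbit_gset G K) f \<one>\<^bsub>T A\<^esub> =
      add_pow (T (orbit_gset G K)) (card (fibre A f (Coset_pt K))) \<one>\<^bsub>T (orbit_gset G K)\<^esub>)"

text \<open>Any finite \<open>G\<close>-set over \<open>G/K\<close> splits into orbits
  \<open>G/L\<close> with \<open>L\<close> inside \<open>K\<close>, and both the transfer of one and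
  the number of points in the fibre add up over them.\<close>

lemma countingI:
  assumes K: "subgroup K G"
    and tr: "\<And>L. \<lbrakk>subgroup L G; L \<subseteq> K\<rbrakk> \<Longrightarrow>
      tr_one K L = add_pow (T (orbit_gset G K)) (sub_index G K L) \<one>\<^bsub>T (orbit_gset G K)\<^esub>"
  shows "counting K"
proof -
  let ?R = "T (orbit_gset G K)"
  interpret R: cring ?R using cring_orbit K .
  show ?thesis
    unfolding counting_def
  proof (intro allI impI)
    fix A :: "'a pset" and f assume A: "fin_gset G A" and f: "f \<in> gmaps G A (orbit_gset G K)"
    show "tr A (orbit_gset G K) f \<one>\<^bsub>T A\<^esub> = add_pow ?R (card (fibre A f (Coset_pt K))) \<one>\<^bsub>?R\<^esub>"
      by (rule orbit_decomposition_induct[where \<Phi> = "\<lambda>\<tau> c w. \<tau> = add_pow ?R c \<one>\<^bsub>?R\<^esub>"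
          and Q = "\<lambda>L. True", OF K _ _ A f])
        (simp_all add: tr R.add.nat_pow_mult)
  qed
qed

lemma counting_tr_one:
  assumes "counting K" "subgroup H G" "subgroup K G" "H \<subseteq> K"
  shows "tr_one K H = add_pow (T (orbit_gset G K)) (sub_index G K H) \<one>\<^bsub>T (orbit_gset G K)\<^esub>"
  using assms(1) fin_gset_orbit[OF assms(2) finite_carrier] orbit_proj_gmaps[OF assms(2-4)]
    card_fibre_orbit_proj[OF assms(2-4)] by (simp add: counting_def)

text \<open>By reciprocity the product is the transfer from \<open>G/L\<close> of the restriction of
  \<open>tr_one K H\<close>. That restriction is a transfer of one from a pullback whose fibres have
  \<open>|K/H|\<close> points, so \<open>counting L\<close> makes it this integer.\<close>

lemma tr_one_mult:
  assumes L: "subgroup L G" and H: "subgroup H G" and K: "subgroup K G" and LK: "L \<subseteq> K" and HK: "H \<subseteq> K"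
    and "counting L"
  shows "tr_one K H \<otimes>\<^bsub>T (orbit_gset G K)\<^esub> tr_one K L =
    add_pow (T (orbit_gset G K)) (sub_index G K H) (tr_one K L)"
proof -
  let ?X = "orbit_gset G H" and ?Y = "orbit_gset G L" and ?B = "orbit_gset G K"
  let ?f = "orbit_proj G H K" and ?g = "orbit_proj G L K"
  note X = fin_gset_orbit[OF H finite_carrier] and Y = fin_gset_orbit[OF L finite_carrier]
    and B = fin_gset_orbit[OF K finite_carrier]
    and f = orbit_proj_gmaps[OF H K HK] and g = orbit_proj_gmaps[OF L K LK]
  let ?P = "pullback_gset ?X ?f ?Y ?g" and ?s = "pullback_snd ?X ?f ?Y ?g"
  note P = fin_gset_pullback[OF X Y f g] and fst = pullback_fst_gmaps[OF X Y f g]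
    and snd = pullback_snd_gmaps[OF X Y f g]
  interpret RY: cring "T ?Y" using cring Y .
  have pt: "Coset_pt L \<in> pts ?Y" "?g (Coset_pt L) = Coset_pt K"
    using coset_pt_closed[OF one_closed, of L] orbit_proj_coset_pt[OF L K LK one_closed]
    by (simp_all add: coset_pt_one L K)
  have "res ?Y ?B ?g (tr_one K H) = tr ?P ?Y ?s \<one>\<^bsub>T ?P\<^esub>"
    using res_tr[OF X B Y f g one_closed_T[OF X]] res_one[OF P X fst] by simp
  also have "\<dots> = add_pow (T ?Y) (sub_index G K H) \<one>\<^bsub>T ?Y\<^esub>"
    using assms(6) P snd card_fibre_pullback_snd[OF pt(1), of ?X ?f ?g] pt(2) card_fibre_orbit_proj[OF H K HK]
    by (simp add: counting_def)
  finally show ?thesis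
    using frobenius[OF Y B g tr_one_closed[OF H K HK] one_closed_T[OF Y]]
      tr_add_pow[OF Y B g one_closed_T[OF Y]] by simp
qed

end

section \<open>Maximal subgroups: two values of one norm\<close>

locale multiplicatively_cohomological_tambara_functor = finite_tambara_functor +
  assumes mult_cohomological: "multiplicatively_cohomological G T res nm"
begin

lemma tr_one_maximal:
  assumes max: "maximal_in H K"
    and IH: "\<And>L. \<lbrakk>subgroup L G; L \<subset> K\<rbrakk> \<Longrightarrow> counting L"
  shows "tr_one K H = add_pow (T (orbit_gset G K)) (sub_index G K H) \<one>\<^bsub>T (orbit_gset G K)\<^esub>"
proof -
  let ?B = "orbit_gset G K"
  let ?R = "T ?B"
  have H: "subgroup H G" and K: "subgroup K G" and HK: "H \<subseteq> K" "H \<noteq> K"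
    and between: "\<And>M. \<lbrakk>subgroup M G; H \<subseteq> M; M \<subseteq> K\<rbrakk> \<Longrightarrow> M = H \<or> M = K"
    using max by (auto simp: maximal_in_def)
  interpret R: cring ?R using cring_orbit K .
  note B = fin_gset_orbit[OF K finite_carrier]
  have cH: "counting H"
    using IH[OF H] HK by blast
  define x where "x = tr_one K H"
  define n where "n = sub_index G K H"
  have n: "n > 0"
    using sub_index_pos[OF H K HK(1) finite_carrier] by (simp add: n_def)
  have x: "x \<in> carrier ?R"
    using tr_one_closed[OF H K HK(1)] by (simp add: x_def)
  let ?m = "\<lambda>k. add_pow ?R (k::nat)"
  have x_mult: "x \<otimes>\<^bsub>?R\<^esub> x = ?m n x"
    using tr_one_mult[OF H H K HK(1) HK(1) cH] by (simp add: x_def n_def)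
  have x_pow: "x [^]\<^bsub>?R\<^esub> Suc k = ?m (n ^ k) x" for k
  proof (induction k)
    case (Suc k)
    have "x [^]\<^bsub>?R\<^esub> Suc (Suc k) = ?m (n ^ k) x \<otimes>\<^bsub>?R\<^esub> x"
      using Suc by simp
    also have "\<dots> = ?m (n ^ Suc k) x"
      using x by (simp add: R.add_pow_ldistr x_mult R.add.nat_pow_pow)
    finally show ?case .
  qed (use x in simp)

  define X where "X = orbit_gset G H"
  define f where "f = orbit_proj G H K"
  define A where "A = pullback_gset X f X f"
  define q where "q = pullback_snd X f X f"
  define D where "D = dep_prod_gset G A q X f ?B"
  define p where "p = dep_prod_proj G A q X f ?B"
  note defs = X_def f_def A_def q_def D_def p_def
  interpret dep: dep_prod G A X ?B q f
    using nm_res_tr_one(1)[OF H K HK(1)] by (simp add: defs)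
  have D: "fin_gset G D" and p: "p \<in> gmaps G D ?B"
    using dep.fin_gset_D dep.p_gmaps by (simp_all add: D_def p_def)
  let ?\<tau> = "tr D ?B p \<one>\<^bsub>T D\<^esub>" and ?F = "fibre D p (Coset_pt K)"
  let ?W = "{d \<in> ?F. \<forall>k\<in>K. act D k d = d}"
  have "?\<tau> = nm X ?B f (res X ?B f x)"
    using nm_res_tr_one(2)[OF H K HK(1)] by (simp add: defs x_def)
  also have "\<dots> = x [^]\<^bsub>?R\<^esub> n"
    using mult_cohomological H K HK(1) x
    by (simp add: multiplicatively_cohomological_def nm_sub_def res_sub_def X_def f_def n_def)
  also have "\<dots> = ?m (n ^ (n - 1)) x"
    using x_pow[of "n - 1"] n by simp
  finally have \<tau>: "?\<tau> = ?m (n ^ (n - 1)) x" .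
  have card_F: "card ?F = n ^ n"
    using nm_res_tr_one(3)[OF H K HK(1)] by (simp add: defs n_def)
  have card_W: "card ?W = card (fixed_fibre K H)"
    using card_fixed_eq[OF H K HK(1)] by (simp add: defs)
  have nn: "n ^ n = n ^ (n - 1) * n"
    using n by (simp flip: power_Suc2)
  have "x = ?m n \<one>\<^bsub>?R\<^esub>"
    using fixed_fibre_maximal[OF finite_carrier max]
  proof
    assume "fixed_fibre K H = {Coset_pt H}"
    then have W: "card ?W = 1"
      using card_W by simp
    \<comment> \<open>After multiplication by \<open>n\<close>, each of the \<open>w\<close> fixed
      points contributes \<open>n\<close> copies of one and each of the other \<open>c - w\<close>
      points one copy of \<open>x\<close>. The bound \<open>w \<le> c\<close> makes the subtraction
      of natural numbers a true one.\<close>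
    have "card ?W \<le> card ?F \<and> ?m n ?\<tau> = ?m (n * card ?W) \<one>\<^bsub>?R\<^esub> \<oplus>\<^bsub>?R\<^esub> ?m (card ?F - card ?W) x"
    proof (rule orbit_decomposition_induct[where Q = "\<lambda>L. True" and
          \<Phi> = "\<lambda>\<tau> c w. w \<le> c \<and> ?m n \<tau> = ?m (n * w) \<one>\<^bsub>?R\<^esub> \<oplus>\<^bsub>?R\<^esub> ?m (c - w) x", OF K _ _ D p])
      fix \<tau> and c w :: nat and L
      assume IH': "w \<le> c \<and> ?m n \<tau> = ?m (n * w) \<one>\<^bsub>?R\<^esub> \<oplus>\<^bsub>?R\<^esub> ?m (c - w) x"
        and \<tau>: "\<tau> \<in> carrier ?R" and L: "subgroup L G" and LK: "L \<subseteq> K"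
      let ?y = "tr_one K L" and ?k = "sub_index G K L" and ?\<epsilon> = "if L = K then 1 else 0 :: nat"
      have y: "?y \<in> carrier ?R"
        using tr_one_closed[OF L K LK] .
      have \<epsilon>: "?\<epsilon> \<le> ?k"
        using sub_index_pos[OF L K LK finite_carrier] by auto
      have "?m n ?y = ?m (n * ?\<epsilon>) \<one>\<^bsub>?R\<^esub> \<oplus>\<^bsub>?R\<^esub> ?m (?k - ?\<epsilon>) x"
      proof (cases "L = K")
        case True
        then show ?thesis
          using tr_one_self[OF K] sub_index_self[OF K finite_carrier] by simp
      next
        case False
        \<comment> \<open>The product is evaluated in both orders, by \<open>counting L\<close> and
          by \<open>counting H\<close>; both subgroups are proper in \<open>K\<close>.\<close>
        have "?m n ?y = x \<otimes>\<^bsub>?R\<^esub> ?y"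
          using tr_one_mult[OF L H K LK HK(1)] IH[OF L] LK False by (auto simp: x_def n_def)
        also have "\<dots> = ?y \<otimes>\<^bsub>?R\<^esub> x"
          using x y by (rule R.m_comm)
        also have "\<dots> = ?m ?k x"
          using tr_one_mult[OF H L K HK(1) LK cH] by (simp add: x_def)
        finally show ?thesis
          using False x by simp
      qed
      then have "?m n (?y \<oplus>\<^bsub>?R\<^esub> \<tau>) = (?m (n * ?\<epsilon>) \<one>\<^bsub>?R\<^esub> \<oplus>\<^bsub>?R\<^esub> ?m (?k - ?\<epsilon>) x) \<oplus>\<^bsub>?R\<^esub>
          (?m (n * w) \<one>\<^bsub>?R\<^esub> \<oplus>\<^bsub>?R\<^esub> ?m (c - w) x)"
        using IH' y \<tau> by (simp only: R.add.nat_pow_distrib)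
      also have "\<dots> = (?m (n * ?\<epsilon>) \<one>\<^bsub>?R\<^esub> \<oplus>\<^bsub>?R\<^esub> ?m (n * w) \<one>\<^bsub>?R\<^esub>) \<oplus>\<^bsub>?R\<^esub>
          (?m (?k - ?\<epsilon>) x \<oplus>\<^bsub>?R\<^esub> ?m (c - w) x)"
        using x by (simp add: R.a_ac)
      also have "\<dots> = ?m (n * (?\<epsilon> + w)) \<one>\<^bsub>?R\<^esub> \<oplus>\<^bsub>?R\<^esub> ?m ((?k - ?\<epsilon>) + (c - w)) x"
        using x by (simp only: R.add.nat_pow_mult R.one_closed distrib_left)
      also have "(?k - ?\<epsilon>) + (c - w) = (?k + c) - (?\<epsilon> + w)"
        using \<epsilon> IH' by linarith
      finally have "?m n (?y \<oplus>\<^bsub>?R\<^esub> \<tau>) =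
          ?m (n * (?\<epsilon> + w)) \<one>\<^bsub>?R\<^esub> \<oplus>\<^bsub>?R\<^esub> ?m ((?k + c) - (?\<epsilon> + w)) x" .
      moreover have "?\<epsilon> + w \<le> ?k + c"
        using \<epsilon> IH' by linarith
      ultimately show "?\<epsilon> + w \<le> ?k + c \<and> ?m n (?y \<oplus>\<^bsub>?R\<^esub> \<tau>) =
          ?m (n * (?\<epsilon> + w)) \<one>\<^bsub>?R\<^esub> \<oplus>\<^bsub>?R\<^esub> ?m ((?k + c) - (?\<epsilon> + w)) x"
        by blast
    qed simp_all
    then have "?m (n ^ n) x = ?m n \<one>\<^bsub>?R\<^esub> \<oplus>\<^bsub>?R\<^esub> ?m (n ^ n - 1) x"
      using x by (simp add: W card_F \<tau> R.add.nat_pow_pow nn)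
    \<comment> \<open>With one copy of \<open>x\<close> split off, the same multiple of
      \<open>x\<close> stands on both sides and cancels.\<close>
    moreover have "?m (n ^ n) x = x \<oplus>\<^bsub>?R\<^esub> ?m (n ^ n - 1) x"
      using R.add.nat_pow_Suc2[OF x, of "n ^ n - 1"] n by simp
    ultimately show "x = ?m n \<one>\<^bsub>?R\<^esub>"
      using x by simp
  next
    assume triv: "fixed_fibre K H = coset_pt H ` K"
    then have W: "card ?W = n"
      using card_W fibre_orbit_proj[OF H K HK(1)] card_fibre_orbit_proj[OF H K HK(1)] by (simp add: n_def)
    have stab: "H \<subseteq> stabilizer G (act D) d" if "d \<in> ?F" for d
      using stabilizer_supset[OF H K HK(1) triv, of d] that by (simp add: defs)
    \<comment> \<open>\<open>m\<close> counts the orbits \<open>K/H\<close>, of \<open>n\<close>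
      points each. All stabilizers contain \<open>H\<close>, so maximality leaves only
      \<open>H\<close> and \<open>K\<close>, and an orbit contributes exactly \<open>x\<close> or
      one.\<close>
    have "\<exists>m. card ?F = card ?W + n * m \<and> ?\<tau> = ?m (card ?W) \<one>\<^bsub>?R\<^esub> \<oplus>\<^bsub>?R\<^esub> ?m m x"
    proof (rule orbit_decomposition_induct[where Q = "\<lambda>L. H \<subseteq> L" and
          \<Phi> = "\<lambda>\<tau> c w. \<exists>m. c = w + n * m \<and> \<tau> = ?m w \<one>\<^bsub>?R\<^esub> \<oplus>\<^bsub>?R\<^esub> ?m m x", OF K _ _ D p])
      fix \<tau> and c w :: nat and L
      assume "\<exists>m. c = w + n * m \<and> \<tau> = ?m w \<one>\<^bsub>?R\<^esub> \<oplus>\<^bsub>?R\<^esub> ?m m x"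
        and L: "subgroup L G" and LK: "L \<subseteq> K" and HL: "H \<subseteq> L"
      then obtain m where m: "c = w + n * m" "\<tau> = ?m w \<one>\<^bsub>?R\<^esub> \<oplus>\<^bsub>?R\<^esub> ?m m x" by blast
      consider "L = K" | "L = H"
        using between[OF L HL LK] by blast
      then show "\<exists>m. sub_index G K L + c = (if L = K then 1 else 0) + w + n * m \<and>
          tr_one K L \<oplus>\<^bsub>?R\<^esub> \<tau> = ?m ((if L = K then 1 else 0) + w) \<one>\<^bsub>?R\<^esub> \<oplus>\<^bsub>?R\<^esub> ?m m x"
      proof cases
        case 1
        then show ?thesis
          using m x R.add.nat_pow_Suc2[OF R.one_closed, of w] tr_one_self[OF K] sub_index_self[OF K finite_carrier]
          by (intro exI[of _ m]) (simp add: R.a_assoc)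
      next
        case 2
        then show ?thesis
          using m x R.add.nat_pow_Suc2[OF x, of m] HK(2)
          by (intro exI[of _ "Suc m"]) (simp add: R.a_lcomm flip: x_def n_def)
      qed
    qed (use stab in \<open>auto intro!: exI[of _ "0 :: nat"]\<close>)
    then obtain m where m: "n ^ n = n + n * m" "?m (n ^ (n - 1)) x = ?m n \<one>\<^bsub>?R\<^esub> \<oplus>\<^bsub>?R\<^esub> ?m m x"
      by (auto simp: W card_F \<tau>)
    \<comment> \<open>Counting points gives \<open>m = n ^ (n - 1) - 1\<close>; the factor
      \<open>n\<close> is cancelled among natural numbers, not in the ring.\<close>
    then have "n * n ^ (n - 1) = n * Suc m"
      using nn by (simp add: mult.commute)
    then have "n ^ (n - 1) = Suc m"
      using n by (simp only: mult_cancel1 neq0_conv) simp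
    then have "x \<oplus>\<^bsub>?R\<^esub> ?m m x = ?m n \<one>\<^bsub>?R\<^esub> \<oplus>\<^bsub>?R\<^esub> ?m m x"
      using m(2) R.add.nat_pow_Suc2[OF x, of m] by simp
    then show "x = ?m n \<one>\<^bsub>?R\<^esub>"
      using x by simp
  qed
  then show ?thesis
    by (simp add: x_def n_def)
qed

text \<open>A proper subgroup \<open>H\<close> lies in a maximal one, \<open>M\<close>. The
  hypothesis for \<open>M\<close> makes the transfer of one from \<open>H\<close> to
  \<open>M\<close> the integer \<open>|M/H|\<close>, which passes through the additive transfer to
  \<open>K\<close>; \<open>tr_one_maximal\<close> treats the remaining factor.\<close>

lemma counting_subgroup: "subgroup K G \<Longrightarrow> counting K"
proof (induction "card K" arbitrary: K rule: less_induct)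
  case less
  note K = less.prems
  let ?B = "orbit_gset G K"
  let ?R = "T ?B"
  interpret R: cring ?R using cring_orbit K .
  have IH: "counting L" if "subgroup L G" "L \<subset> K" for L
    using less.hyps[OF psubset_card_mono that(1)] that(2)
      finite_subset[OF subgroup.subset[OF K] finite_carrier] by simp
  show ?case
  proof (rule countingI[OF K])
    fix H assume H: "subgroup H G" and HK: "H \<subseteq> K"
    show "tr_one K H = add_pow ?R (sub_index G K H) \<one>\<^bsub>?R\<^esub>"
    proof (cases "H = K")
      case True
      then show ?thesis
        using tr_one_self[OF K] sub_index_self[OF K finite_carrier] by simp
    next
      case False
      then obtain M where M: "maximal_in M K" "H \<subseteq> M"
        using obtain_maximal_in[OF finite_carrier H K] HK by blast
      then have sM: "subgroup M G" and MK: "M \<subset> K"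
        by (auto simp: maximal_in_def)
      note Mset = fin_gset_orbit[OF sM finite_carrier] and B = fin_gset_orbit[OF K finite_carrier]
        and proj = orbit_proj_gmaps[OF sM K psubset_imp_subset[OF MK]]
      have "tr_one K H = tr (orbit_gset G M) ?B (orbit_proj G M K)
          (add_pow (T (orbit_gset G M)) (sub_index G M H) \<one>\<^bsub>T (orbit_gset G M)\<^esub>)"
        using tr_one_trans[OF H sM K M(2)] counting_tr_one[OF IH[OF sM MK] H sM M(2)] MK by simp
      also have "\<dots> = add_pow ?R (sub_index G M H) (tr_one K M)"
        by (rule tr_add_pow[OF Mset B proj one_closed_T[OF Mset]])
      also have "\<dots> = add_pow ?R (sub_index G K H) \<one>\<^bsub>?R\<^esub>"
        using tr_one_maximal[OF M(1) IH] sub_index_trans[OF H sM K M(2) _ finite_carrier] MK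
        by (simp add: R.add.nat_pow_pow)
      finally show ?thesis .
    qed
  qed
qed

lemma additively_cohomological: "additively_cohomological G T res tr"
  unfolding additively_cohomological_def
proof (intro allI impI ballI)
  fix H K t
  assume "subgroup H G \<and> subgroup K G \<and> H \<subseteq> K" and t: "t \<in> carrier (T (orbit_gset G K))"
  then have H: "subgroup H G" and K: "subgroup K G" and HK: "H \<subseteq> K"
    by auto
  let ?X = "orbit_gset G H" and ?B = "orbit_gset G K" and ?f = "orbit_proj G H K"
  note X = fin_gset_orbit[OF H finite_carrier] and B = fin_gset_orbit[OF K finite_carrier]
    and f = orbit_proj_gmaps[OF H K HK]
  interpret R: cring "T ?B" using cring B .
  interpret RX: cring "T ?X" using cring X .
  have "tr ?X ?B ?f (res ?X ?B ?f t) = t \<otimes>\<^bsub>T ?B\<^esub> tr_one K H"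
    using frobenius[OF X B f t one_closed_T[OF X]] res_closed[OF X B f t] by simp
  also have "\<dots> = add_pow (T ?B) (sub_index G K H) t"
    using counting_tr_one[OF counting_subgroup[OF K] H K HK] t by (simp add: R.add_pow_rdistr)
  finally show "tr_sub G tr K H (res_sub G res K H t) = add_pow (T ?B) (sub_index G K H) t"
    by (simp add: tr_sub_def res_sub_def)
qed

end

theorem theorem1:
  fixes G :: "('g, 'm) monoid_scheme"
    and T :: "'g pset \<Rightarrow> ('r, 'n) ring_scheme"
    and res tr nm :: "'g pset \<Rightarrow> 'g pset \<Rightarrow> ('g point \<Rightarrow> 'g point) \<Rightarrow> 'r \<Rightarrow> 'r"
  assumes "group G" and "finite (carrier G)"
    and "tambara_functor G T res tr nm"
    and "multiplicatively_cohomological G T res nm"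
  shows "additively_cohomological G T res tr"
proof -
  interpret tambara_functor G T res tr nm by fact
  interpret multiplicatively_cohomological_tambara_functor G T res tr nm
    by unfold_locales (use assms(2,4) in auto)
  show ?thesis
    by (rule additively_cohomological)
qed

end
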